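(* Let $\mathcal{SV}$ be the Schrödinger-Virasoro conformal algebra, let $\alpha,\beta\in\mathbb{C}$, and let $M_{\alpha,\beta}=\mathbb{C}[\partial]v$ be the $\mathcal{SV}$-module, free of rank one over $\mathbb{C}[\partial]$, with $L_\lambda v=(\partial+\alpha\lambda+\beta)v$ and $Y_\lambda v=M_\lambda v=0$. If $\beta\neq 0$, then the reduced cohomology satisfies $H^q(\mathcal{SV},M_{\alpha,\beta})=0$ for every $q\in\mathbb{Z}_+$.
   Context: All vector spaces and tensor products are over $\mathbb{C}$; $\mathbb{Z}_+$ is the set of nonnegative integers. A Lie conformal algebra $\mathcal{A}$ is a $\mathbb{C}[\partial]$-module with a $\mathbb{C}$-bilinear map $\mathcal{A}\otimes\mathcal{A}\to\mathbb{C}[\lambda]\otimes\mathcal{A}$, $a\otimes b\mapsto[a_\lambda b]$, such that for all $a,b,c\in\mathcal{A}$: $[(\partial a)_\lambda b]=-\lambda[a_\lambda b]$, $[a_\lambda(\partial b)]=(\partial+\lambda)[a_\lambda b]$, $[a_\lambda b]=-[b_{-\lambda-\partial}a]$, and $[a_\lambda[b_\mu c]]=[[a_\lambda b]_{\lambda+\mu}c]+[b_\mu[a_\lambda c]]$. The Schrödinger-Virasoro conformal algebra is $\mathcal{SV}=\mathbb{C}[\partial]L\oplus\mathbb{C}[\partial]M\oplus\mathbb{C}[\partial]Y$ (free $\mathbb{C}[\partial]$-module of rank 3) with nontrivial $\lambda$-brackets of generators $$[L_\lambda L]=(\partial+2\lambda)L,\quad [L_\lambda Y]=(\partial+\tfrac32\lambda)Y,\quad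 [Y_\lambda L]=(\tfrac12\partial+\tfrac32\lambda)Y,$$ $$[Y_\lambda Y]=(\partial+2\lambda)M,\quad [L_\lambda M]=(\partial+\lambda)M,\quad [M_\lambda L]=\lambda M,$$ all other $\lambda$-brackets of generators being zero. A conformal module $V$ over $\mathcal{A}$ is a $\mathbb{C}[\partial]$-module with a $\mathbb{C}$-bilinear map $\mathcal{A}\otimes V\to V[\lambda]$, $a\otimes v\mapsto a_\lambda v$, such that $a_\lambda(b_\mu v)-b_\mu(a_\lambda v)=[a_\lambda b]_{\lambda+\mu}v$, $(\partial a)_\lambda v=-\lambda a_\lambda v$, and $a_\lambda(\partial v)=(\partial+\lambda)a_\lambda v$ for all $a,b\in\mathcal{A}$, $v\in V$. Basic complex. For $n\in\mathbb{Z}_+$, $\tilde C^n(\mathcal{A},V)$ is the space of $n$-cochains: $\mathbb{C}$-linear maps $\gamma:\mathcal{A}^{\otimes n}\to V[\lambda_1,\ldots,\lambda_n]$, $a_1\otimes\cdots\otimes a_n\mapsto\gamma_{\lambda_1,\ldots,\lambda_n}(a_1,\ldots,a_n)$, such that (1) $\gamma_{\lambda_1,\ldots,\lambda_n}(a_1,\ldots,\partial a_i,\ldots,a_n)=-\lambda_i\gamma_{\lambda_1,\ldots,\lambda_n}(a_1,\ldots,a_n)$ for each $i$; (2) $\gamma$ is skew-symmetric under simultaneous permutations of the $a_i$'s and $\lambda_i$'s. In particular $\tilde C^0(\mathcal{A},V)=V$. The differential $d=d_n:\tilde C^n\to\tilde C^{n+1}$ is \begin{align*}(d\gamma)_{\lambda_1,\ldots,\lambda_{n+1}}(a_1,\ldots,a_{n+1})&=\sum_{i=1}^{n+1}(-1)^{i+1}{a_i}_{\lambda_i}\gamma_{\lambda_1,\ldots,\widehat{\lambda_i},\ldots,\lambda_{n+1}}(a_1,\ldots,\widehat{a_i},\ldots,a_{n+1})\\&\quad+\sum_{1\le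 i<j\le n+1}(-1)^{i+j}\gamma_{\lambda_i+\lambda_j,\lambda_1,\ldots,\widehat{\lambda_i},\ldots,\widehat{\lambda_j},\ldots,\lambda_{n+1}}([{a_i}_{\lambda_i}a_j],a_1,\ldots,\widehat{a_i},\ldots,\widehat{a_j},\ldots,a_{n+1}),\end{align*} where $\gamma$ is extended linearly over polynomials in the $\lambda_i$ (hats denote omission; for $\gamma\in\tilde C^0=V$, $(d_0\gamma)_\lambda(a)=a_\lambda\gamma$); $d^2=0$. Reduced cohomology. Let $\partial$ act on $\tilde C^n(\mathcal{A},V)$ by $(\partial\gamma)_{\lambda_1,\ldots,\lambda_n}(a_1,\ldots,a_n)=\big(\partial_V+\sum_{i=1}^n\lambda_i\big)\gamma_{\lambda_1,\ldots,\lambda_n}(a_1,\ldots,a_n)$, where $\partial_V$ is the action of $\partial$ on $V$. Then $d\partial=\partial d$, so $\partial\tilde C^\bullet$ is a subcomplex of $\tilde C^\bullet$. The reduced complex is the quotient complex $\tilde C^\bullet/\partial\tilde C^\bullet$ with the induced differential, and $H^q(\mathcal{A},V)$ is its $q$-th cohomology. *)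

theory Defs
  imports
    Complex_Main
    "HOL-Computational_Algebra.Polynomial"
    "HOL-Combinatorics.Permutations"
    "HOL-Library.Function_Algebras"
    "HOL-Algebra.Coset"
begin

section \<open>Lie conformal algebras and conformal modules\<close>

text \<open>
  A \<open>\<complex>[\<partial>]\<close>-module is a module (locale \<^locale>\<open>module\<close>) over the ring \<^typ>\<open>complex poly\<close>:
  \<open>\<partial>\<close> acts as \<open>[:0, 1:]\<close> and \<open>c \<in> \<complex>\<close> acts as \<open>[:c:]\<close>.

  Since \<open>\<complex>\<close> is infinite, an element of \<open>V[\<lambda>\<^sub>1, \<dots>, \<lambda>\<^sub>n]\<close> is the same thing as a polynomial function
  \<open>\<complex>\<^sup>n \<rightarrow> V\<close> (a function given by finitely many coefficients in \<open>V\<close>). Polynomials in \<open>\<lambda>\<close>'s with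
  coefficients in a module are represented in this way throughout, so that a variable \<open>\<lambda>\<close> always
  ranges over complex numbers.
\<close>

text \<open>
  Substitution of \<open>r \<in> \<complex>[\<partial>]\<close> for \<open>\<lambda>\<close> in \<open>p = \<Sum>\<^sub>k \<lambda>\<^sup>k p\<^sub>k \<in> V[\<lambda>]\<close>. Substituting \<open>[:\<lambda>:]\<close> is evaluation at
  the number \<open>\<lambda>\<close>; substituting \<open>[:-\<lambda>, -1:]\<close> is the substitution of \<open>-\<lambda> - \<partial>\<close>, with the powers of
  \<open>\<partial>\<close> acting on the coefficients.
\<close>

definition poly_subst ::
    "(complex poly \<Rightarrow> 'v \<Rightarrow> 'v) \<Rightarrow> complex poly \<Rightarrow> 'v::ab_group_add poly \<Rightarrow> 'v" where
  "poly_subst scale r p = (\<Sum>k\<le>degree p. scale (r ^ k) (coeff p k))"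

locale lie_conformal_algebra = A: module scaleA
  for scaleA :: "complex poly \<Rightarrow> 'a::ab_group_add \<Rightarrow> 'a" +
  fixes bracket :: "complex \<Rightarrow> 'a \<Rightarrow> 'a \<Rightarrow> 'a"
  assumes bracket_add_left: "bracket l (a + a') b = bracket l a b + bracket l a' b"
    and bracket_add_right: "bracket l a (b + b') = bracket l a b + bracket l a b'"
    and bracket_scale_left: "bracket l (scaleA [:k:] a) b = scaleA [:k:] (bracket l a b)"
    and bracket_scale_right: "bracket l a (scaleA [:k:] b) = scaleA [:k:] (bracket l a b)"
    and bracket_polynomial: "\<exists>p. \<forall>l. bracket l a b = poly_subst scaleA [:l:] p"
    and bracket_del_left: "bracket l (scaleA [:0, 1:] a) b = scaleA [:- l:] (bracket l a b)"
    and bracket_del_right: "bracket l a (scaleA [:0, 1:] b) = scaleA [:l, 1:] (bracket l a b)"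
    and skew_symmetry:
      "(\<And>l'. bracket l' b a = poly_subst scaleA [:l':] p) \<Longrightarrow>
         bracket l a b = - poly_subst scaleA [:- l, - 1:] p"
    and jacobi:
      "bracket l a (bracket m b c) =
         bracket (l + m) (bracket l a b) c + bracket m b (bracket l a c)"

locale conformal_module =
  lie_conformal_algebra scaleA bracket + V: module scaleV
  for scaleA :: "complex poly \<Rightarrow> 'a::ab_group_add \<Rightarrow> 'a"
    and bracket :: "complex \<Rightarrow> 'a \<Rightarrow> 'a \<Rightarrow> 'a"
    and scaleV :: "complex poly \<Rightarrow> 'v::ab_group_add \<Rightarrow> 'v" +
  fixes act :: "complex \<Rightarrow> 'a \<Rightarrow> 'v \<Rightarrow> 'v"
  assumes act_add_left: "act l (a + a') v = act l a v + act l a' v"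
    and act_add_right: "act l a (v + v') = act l a v + act l a v'"
    and act_scale_left: "act l (scaleA [:k:] a) v = scaleV [:k:] (act l a v)"
    and act_scale_right: "act l a (scaleV [:k:] v) = scaleV [:k:] (act l a v)"
    and act_polynomial: "\<exists>p. \<forall>l. act l a v = poly_subst scaleV [:l:] p"
    and act_bracket:
      "act l a (act m b v) - act m b (act l a v) = act (l + m) (bracket l a b) v"
    and act_del_left: "act l (scaleA [:0, 1:] a) v = scaleV [:- l:] (act l a v)"
    and act_del_right: "act l a (scaleV [:0, 1:] v) = scaleV [:l, 1:] (act l a v)"


section \<open>The basic complex, the reduced complex and its cohomology\<close>

context conformal_module
begin

definition polynomial_fun :: "nat \<Rightarrow> (complex list \<Rightarrow> 'v) \<Rightarrow> bool" where
  "polynomial_fun n f \<longleftrightarrow>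
     (\<exists>N c. \<forall>ls. length ls = n \<longrightarrow>
        f ls = (\<Sum>e | length e = n \<and> set e \<subseteq> {..N}. scaleV [:\<Prod>i<n. (ls ! i) ^ (e ! i):] (c e)))"

text \<open>
  A cochain takes the list of pairs \<open>[(a\<^sub>1, \<lambda>\<^sub>1), \<dots>, (a\<^sub>n, \<lambda>\<^sub>n)]\<close> to \<open>\<gamma>\<^bsub>\<lambda>\<^sub>1,\<dots>,\<lambda>\<^sub>n\<^esub>(a\<^sub>1, \<dots>, a\<^sub>n)\<close>. Lists of a
  length other than \<open>n\<close> are sent to \<open>0\<close>, so that \<open>n\<close>-cochains are equal iff they agree on lists of
  length \<open>n\<close>.
\<close>

definition cochains :: "nat \<Rightarrow> (('a \<times> complex) list \<Rightarrow> 'v) set" where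
  "cochains n = {\<gamma>.
     (\<forall>xs. length xs \<noteq> n \<longrightarrow> \<gamma> xs = 0) \<and>
     (\<forall>xs a b l ys. \<gamma> (xs @ (a + b, l) # ys) = \<gamma> (xs @ (a, l) # ys) + \<gamma> (xs @ (b, l) # ys)) \<and>
     (\<forall>xs c a l ys. \<gamma> (xs @ (scaleA [:c:] a, l) # ys) = scaleV [:c:] (\<gamma> (xs @ (a, l) # ys))) \<and>
     (\<forall>as. length as = n \<longrightarrow> polynomial_fun n (\<lambda>ls. \<gamma> (zip as ls))) \<and>
     (\<forall>xs a l ys. \<gamma> (xs @ (scaleA [:0, 1:] a, l) # ys) = scaleV [:- l:] (\<gamma> (xs @ (a, l) # ys))) \<and>
     (\<forall>xs p. p permutes {..<length xs} \<longrightarrow>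
        \<gamma> (permute_list p xs) = scaleV (of_int (sign p)) (\<gamma> xs))}"

text \<open>
  Positions in lists are counted from \<open>0\<close>, which does not affect the parity of \<open>i + 1\<close>, shifted to
  \<open>i + 2\<close>, or of \<open>i + j\<close>, shifted to \<open>i + j + 2\<close>. The term \<open>nths xs (- I)\<close> is \<open>xs\<close> with the entries at
  the positions in \<open>I\<close> omitted. The vector \<open>bracket \<lambda>\<^sub>i a\<^sub>i a\<^sub>j\<close> is the value at the number \<open>\<lambda>\<^sub>i\<close>, so
  linearity of \<open>\<gamma>\<close> accounts for the linear extension over polynomials in the \<open>\<lambda>\<close>'s.
\<close>

definition differential ::
    "(('a \<times> complex) list \<Rightarrow> 'v) \<Rightarrow> ('a \<times> complex) list \<Rightarrow> 'v" where
  "differential \<gamma> xs =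
     (\<Sum>i<length xs. scaleV ((- 1) ^ i)
        (act (snd (xs ! i)) (fst (xs ! i)) (\<gamma> (nths xs (- {i}))))) +
     (\<Sum>j<length xs. \<Sum>i<j. scaleV ((- 1) ^ (i + j))
        (\<gamma> ((bracket (snd (xs ! i)) (fst (xs ! i)) (fst (xs ! j)), snd (xs ! i) + snd (xs ! j))
             # nths xs (- {i, j}))))"

definition del_cochain ::
    "(('a \<times> complex) list \<Rightarrow> 'v) \<Rightarrow> ('a \<times> complex) list \<Rightarrow> 'v" where
  "del_cochain \<gamma> xs = scaleV [:sum_list (map snd xs), 1:] (\<gamma> xs)"

text \<open>The quotients below are taken of the underlying additive groups.\<close>

definition basic_complex :: "nat \<Rightarrow> (('a \<times> complex) list \<Rightarrow> 'v) monoid" where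
  "basic_complex n = \<lparr>carrier = cochains n, mult = (+), one = 0\<rparr>"

definition reduced_complex :: "nat \<Rightarrow> (('a \<times> complex) list \<Rightarrow> 'v) set monoid" where
  "reduced_complex n = basic_complex n Mod (del_cochain ` cochains n)"

text \<open>
  The induced differential: the class of \<open>\<gamma>\<close> is sent to the class of \<open>d \<gamma>\<close>. It does not depend on
  the representative, so the union is over equal cosets.
\<close>

definition reduced_differential ::
    "nat \<Rightarrow> (('a \<times> complex) list \<Rightarrow> 'v) set \<Rightarrow> (('a \<times> complex) list \<Rightarrow> 'v) set" where
  "reduced_differential n X =
     (\<Union>\<gamma>\<in>X. (del_cochain ` cochains (Suc n)) #>\<^bsub>basic_complex (Suc n)\<^esub> differential \<gamma>)"

definition reduced_cocycles :: "nat \<Rightarrow> (('a \<times> complex) list \<Rightarrow> 'v) set set" where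
  "reduced_cocycles n =
     kernel (reduced_complex n) (reduced_complex (Suc n)) (reduced_differential n)"

definition reduced_coboundaries :: "nat \<Rightarrow> (('a \<times> complex) list \<Rightarrow> 'v) set set" where
  "reduced_coboundaries n =
     (case n of
        0 \<Rightarrow> {\<one>\<^bsub>reduced_complex 0\<^esub>}
      | Suc m \<Rightarrow> reduced_differential m ` carrier (reduced_complex m))"

definition reduced_cohomology :: "nat \<Rightarrow> (('a \<times> complex) list \<Rightarrow> 'v) set set monoid" where
  "reduced_cohomology n =
     (reduced_complex n)\<lparr>carrier := reduced_cocycles n\<rparr> Mod reduced_coboundaries n"

end


section \<open>The Schroedinger-Virasoro conformal algebra and the modules \<open>M\<^bsub>\<alpha>,\<beta>\<^esub>\<close>\<close>

datatype sv_gen = GenL | GenM | GenY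

text \<open>The free \<open>\<complex>[\<partial>]\<close>-module on \<open>L, M, Y\<close>; an element is its family of coordinates.\<close>

type_synonym sv = "sv_gen \<Rightarrow> complex poly"

definition sv_scale :: "complex poly \<Rightarrow> sv \<Rightarrow> sv" where
  "sv_scale p f = (\<lambda>g. p * f g)"

definition sv_basis :: "sv_gen \<Rightarrow> sv" where
  "sv_basis g = (\<lambda>h. if h = g then 1 else 0)"

fun sv_bracket_gen :: "complex \<Rightarrow> sv_gen \<Rightarrow> sv_gen \<Rightarrow> sv" where
  "sv_bracket_gen l GenL GenL = sv_scale [:2 * l, 1:] (sv_basis GenL)"
| "sv_bracket_gen l GenL GenY = sv_scale [:3 / 2 * l, 1:] (sv_basis GenY)"
| "sv_bracket_gen l GenY GenL = sv_scale [:3 / 2 * l, 1 / 2:] (sv_basis GenY)"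
| "sv_bracket_gen l GenY GenY = sv_scale [:2 * l, 1:] (sv_basis GenM)"
| "sv_bracket_gen l GenL GenM = sv_scale [:l, 1:] (sv_basis GenM)"
| "sv_bracket_gen l GenM GenL = sv_scale [:l:] (sv_basis GenM)"
| "sv_bracket_gen l GenY GenM = 0"
| "sv_bracket_gen l GenM GenY = 0"
| "sv_bracket_gen l GenM GenM = 0"

text \<open>
  By sesquilinearity, \<open>[(f(\<partial>) x)\<^sub>\<lambda> (g(\<partial>) y)] = f(-\<lambda>) g(\<partial> + \<lambda>) [x\<^sub>\<lambda> y]\<close> and
  \<open>(f(\<partial>) x)\<^sub>\<lambda> (g(\<partial>) v) = f(-\<lambda>) g(\<partial> + \<lambda>) x\<^sub>\<lambda> v\<close>; this determines the bracket and the action from their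
  values on generators.
\<close>

definition sv_bracket :: "complex \<Rightarrow> sv \<Rightarrow> sv \<Rightarrow> sv" where
  "sv_bracket l f g =
     (\<Sum>x\<in>{GenL, GenM, GenY}. \<Sum>y\<in>{GenL, GenM, GenY}.
        sv_scale ([:poly (f x) (- l):] * (g y \<circ>\<^sub>p [:l, 1:])) (sv_bracket_gen l x y))"

fun sv_rank_one_act_gen :: "complex \<Rightarrow> complex \<Rightarrow> complex \<Rightarrow> sv_gen \<Rightarrow> complex poly" where
  "sv_rank_one_act_gen \<alpha> \<beta> l GenL = [:\<alpha> * l + \<beta>, 1:]"
| "sv_rank_one_act_gen \<alpha> \<beta> l GenM = 0"
| "sv_rank_one_act_gen \<alpha> \<beta> l GenY = 0"

text \<open>\<open>M\<^bsub>\<alpha>,\<beta>\<^esub> = \<complex>[\<partial>]v\<close> is \<^typ>\<open>complex poly\<close> as a module over itself, with \<open>v = 1\<close>.\<close>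

definition sv_rank_one_act ::
    "complex \<Rightarrow> complex \<Rightarrow> complex \<Rightarrow> sv \<Rightarrow> complex poly \<Rightarrow> complex poly" where
  "sv_rank_one_act \<alpha> \<beta> l f w =
     (\<Sum>x\<in>{GenL, GenM, GenY}.
        [:poly (f x) (- l):] * (w \<circ>\<^sub>p [:l, 1:]) * sv_rank_one_act_gen \<alpha> \<beta> l x)"


subsection \<open>The axioms hold\<close>

lemma sv_bracket_basis: "sv_bracket l (sv_basis x) (sv_basis y) = sv_bracket_gen l x y"
  by (cases x; cases y)
     (simp_all add: sv_bracket_def sv_basis_def sv_scale_def fun_eq_iff pcompose_1)

lemma sv_rank_one_act_basis:
  "sv_rank_one_act \<alpha> \<beta> l (sv_basis x) 1 = sv_rank_one_act_gen \<alpha> \<beta> l x"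
  by (cases x) (simp_all add: sv_rank_one_act_def sv_basis_def pcompose_1)

lemma poly_sv_bracket:
  "poly (sv_bracket l f g h) x =
     (case h of
        GenL \<Rightarrow> poly (f GenL) (- l) * poly (g GenL) (l + x) * (x + 2 * l)
      | GenM \<Rightarrow> poly (f GenL) (- l) * poly (g GenM) (l + x) * (x + l)
              + poly (f GenM) (- l) * poly (g GenL) (l + x) * l
              + poly (f GenY) (- l) * poly (g GenY) (l + x) * (x + 2 * l)
      | GenY \<Rightarrow> poly (f GenL) (- l) * poly (g GenY) (l + x) * (x + 3 / 2 * l)
              + poly (f GenY) (- l) * poly (g GenL) (l + x) * (x / 2 + 3 / 2 * l))"
  by (cases h) (simp_all add: sv_bracket_def sv_scale_def sv_basis_def poly_pcompose algebra_simps)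

lemma poly_sv_rank_one_act:
  "poly (sv_rank_one_act \<alpha> \<beta> l f w) x = poly (f GenL) (- l) * poly w (l + x) * (x + \<alpha> * l + \<beta>)"
  by (simp add: sv_rank_one_act_def poly_pcompose algebra_simps)

lemma sv_eqI: "(\<And>h x. poly (f h) x = poly (g h) x) \<Longrightarrow> f = g" for f g :: sv
  by (intro ext) (simp flip: poly_eq_poly_eq_iff add: fun_eq_iff)

lemma cpoly_eqI: "(\<And>x. poly p x = poly q x) \<Longrightarrow> p = q" for p q :: "complex poly"
  by (simp flip: poly_eq_poly_eq_iff add: fun_eq_iff)

definition lambda_poly :: "(complex \<Rightarrow> complex poly) \<Rightarrow> bool" where
  "lambda_poly F \<longleftrightarrow> (\<exists>P. \<forall>l. F l = poly P [:l:])"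

lemma lambda_poly_const: "lambda_poly (\<lambda>_. p)"
  unfolding lambda_poly_def by (intro exI[of _ "[:p:]"]) simp

lemma lambda_poly_var: "lambda_poly (\<lambda>l. [:l:])"
  unfolding lambda_poly_def by (intro exI[of _ "[:0, 1:]"]) simp

lemma lambda_poly_add: "lambda_poly F \<Longrightarrow> lambda_poly G \<Longrightarrow> lambda_poly (\<lambda>l. F l + G l)"
  unfolding lambda_poly_def by (metis poly_add)

lemma lambda_poly_mult: "lambda_poly F \<Longrightarrow> lambda_poly G \<Longrightarrow> lambda_poly (\<lambda>l. F l * G l)"
  unfolding lambda_poly_def by (metis poly_mult)

lemma lambda_poly_lin: "lambda_poly (\<lambda>l. [:c * l + d, e:])"
proof -
  have "(\<lambda>l. [:c * l + d, e:]) = (\<lambda>l. [:c:] * [:l:] + [:d, e:])" by (simp add: fun_eq_iff)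
  then show ?thesis
    by (simp only:) (intro lambda_poly_add lambda_poly_mult lambda_poly_const lambda_poly_var)
qed

lemma lambda_poly_eval: "lambda_poly (\<lambda>l. [:poly f (- l):])"
proof (induction f)
  case 0
  then show ?case by (simp add: lambda_poly_const)
next
  case (pCons a f)
  have "(\<lambda>l. [:poly (pCons a f) (- l):]) = (\<lambda>l. [:a:] + [:-1:] * [:l:] * [:poly f (- l):])"
    by (simp add: fun_eq_iff)
  then show ?case
    by (simp only:)
       (intro lambda_poly_add lambda_poly_mult lambda_poly_const lambda_poly_var pCons.IH)
qed

lemma lambda_poly_shift: "lambda_poly (\<lambda>l. f \<circ>\<^sub>p [:l, 1:])"
proof (induction f)
  case 0
  then show ?case by (simp add: lambda_poly_const)
next
  case (pCons a f)
  have "lambda_poly (\<lambda>l. [:l, 1:])"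
    using lambda_poly_lin[of 1 0 1] by simp
  with pCons.IH show ?case
    unfolding pcompose_pCons by (intro lambda_poly_add lambda_poly_mult lambda_poly_const)
qed

lemma lambda_poly_sum:
  "finite A \<Longrightarrow> (\<And>x. x \<in> A \<Longrightarrow> lambda_poly (F x)) \<Longrightarrow> lambda_poly (\<lambda>l. \<Sum>x\<in>A. F x l)"
  by (induction A rule: finite_induct) (simp_all add: lambda_poly_const lambda_poly_add)

lemma lambda_poly_bracket_gen: "lambda_poly (\<lambda>l. sv_bracket_gen l x y h)"
proof -
  have lin: "lambda_poly (\<lambda>l. [:c * l, e:])" for c e
    using lambda_poly_lin[of c 0 e] by simp
  have lin1: "lambda_poly (\<lambda>l. [:l, e:])" for e
    using lin[of 1 e] by simp
  show ?thesis
    by (cases x; cases y; simp only: sv_bracket_gen.simps sv_scale_def zero_fun_apply)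
       (intro lambda_poly_mult lambda_poly_const lambda_poly_var lin lin1)+
qed

lemma lambda_poly_bracket: "lambda_poly (\<lambda>l. sv_bracket l f g h)"
proof -
  have "(\<lambda>l. sv_bracket l f g h) =
    (\<lambda>l. \<Sum>x\<in>{GenL, GenM, GenY}. \<Sum>y\<in>{GenL, GenM, GenY}.
        [:poly (f x) (- l):] * (g y \<circ>\<^sub>p [:l, 1:]) * sv_bracket_gen l x y h)"
    by (simp add: sv_bracket_def sv_scale_def fun_eq_iff)
  then show ?thesis
    by (simp only:)
       (intro lambda_poly_sum lambda_poly_mult lambda_poly_eval lambda_poly_shift
          lambda_poly_bracket_gen finite.intros)
qed

lemma lambda_poly_act: "lambda_poly (\<lambda>l. sv_rank_one_act \<alpha> \<beta> l f w)"
proof -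
  have "lambda_poly (\<lambda>l. sv_rank_one_act_gen \<alpha> \<beta> l x)" for x
    by (cases x) (simp_all add: lambda_poly_lin lambda_poly_const)
  then show ?thesis
    unfolding sv_rank_one_act_def
    by (intro lambda_poly_sum lambda_poly_mult lambda_poly_eval lambda_poly_shift finite.intros)
qed

lemma poly_subst_cpoly: "poly_subst (*) r P = poly P r"
  by (simp add: poly_subst_def poly_altdef mult.commute)

lemma coeff_sv_poly_sum:
  "coeff (\<Sum>k\<le>N. monom (c k) k) k = (if k \<le> N then c k else 0)" for c :: "nat \<Rightarrow> sv"
  by (simp add: coeff_sum sum.delta')

lemma sum_fun_apply: "(\<Sum>k\<in>A. F k) h = (\<Sum>k\<in>A. F k h)"
  for F :: "'i \<Rightarrow> 'j \<Rightarrow> 'k::ab_group_add"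
  by (induction A rule: infinite_finite_induct) simp_all

lemma poly_subst_sv_apply:
  assumes "degree p \<le> N"
  shows "poly_subst sv_scale r p h = (\<Sum>k\<le>N. r ^ k * coeff p k h)"
proof -
  have "poly_subst sv_scale r p h = (\<Sum>k\<le>degree p. r ^ k * coeff p k h)"
    by (simp add: poly_subst_def sum_fun_apply sv_scale_def)
  also have "\<dots> = (\<Sum>k\<le>N. r ^ k * coeff p k h)"
    by (rule sum.mono_neutral_left) (use assms in \<open>auto simp: coeff_eq_0\<close>)
  finally show ?thesis .
qed

lemma sv_bracket_polynomial: "\<exists>p. \<forall>l. sv_bracket l f g = poly_subst sv_scale [:l:] p"
proof -
  have "\<forall>h. \<exists>P. \<forall>l. sv_bracket l f g h = poly P [:l:]"
    using lambda_poly_bracket[of f g] by (auto simp: lambda_poly_def)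
  then obtain P where P: "\<And>h l. sv_bracket l f g h = poly (P h) [:l:]" by metis
  define N where "N = degree (P GenL) + degree (P GenM) + degree (P GenY)"
  have dN: "degree (P h) \<le> N" for h by (cases h) (simp_all add: N_def)
  define p :: "sv poly" where "p = (\<Sum>k\<le>N. monom (\<lambda>h. coeff (P h) k) k)"
  have cp: "coeff p k = (if k \<le> N then (\<lambda>h. coeff (P h) k) else 0)" for k
    unfolding p_def by (rule coeff_sv_poly_sum)
  have dp: "degree p \<le> N" by (rule degree_le) (simp add: cp)
  have "sv_bracket l f g = poly_subst sv_scale [:l:] p" for l
  proof
    fix h
    have "poly (P h) [:l:] = (\<Sum>k\<le>N. [:l:] ^ k * coeff (P h) k)"
      unfolding poly_altdef
      by (rule sum.mono_neutral_cong_left) (use dN[of h] in \<open>auto simp: coeff_eq_0 mult.commute\<close>)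
    then show "sv_bracket l f g h = poly_subst sv_scale [:l:] p h"
      by (simp add: P poly_subst_sv_apply[OF dp] cp)
  qed
  then show ?thesis by blast
qed

lemma sv_bracket_skew:
  assumes "\<And>l'. sv_bracket l' g f = poly_subst sv_scale [:l':] p"
  shows "sv_bracket l f g = - poly_subst sv_scale [:- l, - 1:] p"
proof (rule sv_eqI)
  fix h x
  have "poly ((poly_subst sv_scale [:- l, - 1:] p) h) x = poly (sv_bracket (- l - x) g f h) x"
    by (simp add: assms poly_subst_sv_apply[OF order.refl] poly_sum)
  then show "poly (sv_bracket l f g h) x = poly ((- poly_subst sv_scale [:- l, - 1:] p) h) x"
    by (cases h) (simp_all add: poly_sv_bracket; simp add: field_simps)+
qed

interpretation sv: lie_conformal_algebra sv_scale sv_bracket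
proof unfold_locales
  fix l a b p
  show "(\<And>l'. sv_bracket l' b a = poly_subst sv_scale [:l':] p) \<Longrightarrow>
         sv_bracket l a b = - poly_subst sv_scale [:- l, - 1:] p"
    by (rule sv_bracket_skew)
next
  fix l m a b c
  show "sv_bracket l a (sv_bracket m b c) =
         sv_bracket (l + m) (sv_bracket l a b) c + sv_bracket m b (sv_bracket l a c)"
  proof (rule sv_eqI)
    fix h x
    show "poly (sv_bracket l a (sv_bracket m b c) h) x =
      poly ((sv_bracket (l + m) (sv_bracket l a b) c + sv_bracket m b (sv_bracket l a c)) h) x"
      by (cases h) (simp_all add: poly_sv_bracket; simp add: field_simps)+
  qed
qed (use sv_bracket_polynomial in
      \<open>auto intro!: sv_eqI simp: sv_scale_def poly_sv_bracket field_simps split: sv_gen.split\<close>)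

interpretation sv_rank_one:
  conformal_module sv_scale sv_bracket "(*)" "sv_rank_one_act \<alpha> \<beta>" for \<alpha> \<beta>
proof unfold_locales
  fix a v
  show "\<exists>p. \<forall>l. sv_rank_one_act \<alpha> \<beta> l a v = poly_subst (*) [:l:] p"
    using lambda_poly_act[of \<alpha> \<beta> a v] by (simp add: lambda_poly_def poly_subst_cpoly)
qed (auto intro!: cpoly_eqI
       simp: poly_sv_rank_one_act poly_sv_bracket sv_scale_def algebra_simps)

abbreviation H_SV ::
    "nat \<Rightarrow> complex \<Rightarrow> complex \<Rightarrow> ((sv \<times> complex) list \<Rightarrow> complex poly) set set monoid" where
  "H_SV q \<alpha> \<beta> \<equiv>
     conformal_module.reduced_cohomology sv_scale sv_bracket (*) (sv_rank_one_act \<alpha> \<beta>) q"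

end

(*
  The 0-th mode of L acts on SV as the derivation \<partial> and on M_{\<alpha>,\<beta>} as \<partial> + \<beta>, so its Lie derivative on
  the basic complex is \<partial> + \<beta>. By Cartan's formula, contraction with L at \<lambda> = 0 is therefore a
  homotopy between \<partial> + \<beta> and 0 that commutes with \<partial>; modulo the image of \<partial>, \<beta> times the
  identity is null-homotopic.

  The same formula, used for contraction with an arbitrary first entry, computes d recursively, and
  shows by induction that d preserves alternating sesquilinear maps and commutes with \<partial>.
*)
theory Submission
  imports Defs
begin

text \<open>Write \<iota> for contraction with \<open>(L, 0)\<close>. A reduced cocycle is
  represented by some f with d f = \<partial> g for a cochain g; f itself may fail to be closed.
  Since L enters at \<lambda> = 0, the homotopy formula becomes \<beta> f + \<partial> f =
  \<partial> \<iota> g + d \<iota> f. Hence f = \<partial> h + d k with h = (\<iota> g - f) /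
  \<beta> and k = \<iota> f / \<beta>, so the class of f is a reduced coboundary.

  Two things shape the formal argument. The differential is given by sums over positions, whose
  signs are hard to track; peeling off the first entry turns them into a recursion on the list, and
  the inductions keep f arbitrary because contraction changes it. Moreover the \<lambda>'s are
  numbers, so polynomial dependence on them is invisible to these identities and is established
  separately for d, for contraction and for \<partial>.\<close>

section \<open>Alternating functions on lists\<close>

text \<open>Only swaps of neighbours are imposed, a condition that contraction inherits and that
  induction on the prefix can verify. Full skew-symmetry is recovered in
  \<open>alternating_permute\<close>.\<close>

definition alternating :: "('x list \<Rightarrow> 'b::ab_group_add) \<Rightarrow> bool" where
  "alternating f \<longleftrightarrow> (\<forall>xs x y ys. f (xs @ x # y # ys) = - f (xs @ y # x # ys))"

lemma alternatingD: "alternating f \<Longrightarrow> f (xs @ x # y # ys) = - f (xs @ y # x # ys)"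
  unfolding alternating_def by blast

lemma alternating_swap: "alternating f \<Longrightarrow> f (x # y # ys) = - f (y # x # ys)"
  using alternatingD[of f "[]" x y ys] by (simp only: append_Nil)

lemma alternating_Cons: "alternating f \<Longrightarrow> alternating (\<lambda>xs. f (x # xs))"
  unfolding alternating_def by (metis append_Cons)

text \<open>Each entry of \<open>xs\<close> that \<open>x\<close> passes costs one sign. This
  carries properties of the first entry over to every position.\<close>

lemma alternating_move:
  assumes "alternating f"
  shows "f (xs @ x # ys) = (if even (length xs) then f (x # xs @ ys) else - f (x # xs @ ys))"
proof (induction xs arbitrary: ys rule: rev_induct)
  case (snoc y xs)
  have "f ((xs @ [y]) @ x # ys) = - f (xs @ x # y # ys)"
    using alternatingD[OF assms, of xs y x ys] by simp
  then show ?case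
    unfolding snoc.IH[of "y # ys"] by simp
qed simp

lemma alternating_add: "alternating f \<Longrightarrow> alternating g \<Longrightarrow> alternating (\<lambda>xs. f xs + g xs)"
  unfolding alternating_def by (metis add_uminus_conv_diff minus_add_distrib)

section \<open>From adjacent swaps to arbitrary permutations\<close>

lemma permute_list_adjacent:
  "permute_list (Transposition.transpose (length xs) (Suc (length xs))) (xs @ x # y # ys)
    = xs @ y # x # ys"
proof (rule nth_equalityI)
  fix i
  assume i: "i < length (permute_list (Transposition.transpose (length xs) (Suc (length xs)))
    (xs @ x # y # ys))"
  have "i < length xs \<or> i = length xs \<or> i = Suc (length xs) \<or>
      (\<exists>j. i = length xs + Suc (Suc j))"
    by (metis add_Suc_right less_natE linorder_neqE_nat not_less_eq)
  then show "permute_list (Transposition.transpose (length xs) (Suc (length xs)))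
      (xs @ x # y # ys) ! i = (xs @ y # x # ys) ! i"
    using i by (auto simp: permute_list_def nth_append Transposition.transpose_def simp del: upt_Suc)
qed simp

lemma alternating_permute_adjacent:
  assumes "alternating f" "Suc i < length zs"
  shows "f (permute_list (Transposition.transpose i (Suc i)) zs) = - f zs"
proof -
  define xs ys where "xs = take i zs" and "ys = drop (Suc (Suc i)) zs"
  have zs: "zs = xs @ zs ! i # zs ! Suc i # ys"
    unfolding xs_def ys_def using assms(2) by (simp add: Cons_nth_drop_Suc)
  have "i = length xs"
    using assms(2) by (simp add: xs_def)
  then show ?thesis
    using permute_list_adjacent[of xs "zs ! i" "zs ! Suc i" ys] alternatingD[OF assms(1)] zs
    by metis
qed

text \<open>Every adjacent transposition composed on the left flips both the sign of the value and
  the parity of the permutation. It acts on the list before the rest does, so the list has to vary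
  in the induction.\<close>

lemma alternating_permute_transpositions:
  assumes "alternating f" and p: "p permutes {..<length zs}"
    and "\<forall>i\<in>set is. Suc i < length zs"
    and IH: "\<And>zs'. length zs' = length zs \<Longrightarrow> f (permute_list p zs') = (if evenperm p then f zs' else - f zs')"
  shows "f (permute_list (apply_adj_transps is \<circ> p) zs) =
    (if evenperm (apply_adj_transps is \<circ> p) then f zs else - f zs)"
  using assms(2-)
proof (induction "is" arbitrary: zs)
  case Nil
  then show ?case by simp
next
  case (Cons i js)
  let ?t = "Transposition.transpose i (Suc i)" and ?q = "apply_adj_transps js \<circ> p"
  have perm: "?q permutes {..<length zs}"
    using Cons.prems by (intro permutes_compose permutes_apply_adj_transps) auto
  have t: "?t permutes {..<length zs}"
    using Cons.prems by (intro permutes_swap_id) auto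
  have IH: "f (permute_list ?q (permute_list ?t zs)) =
      (if evenperm ?q then f (permute_list ?t zs) else - f (permute_list ?t zs))"
    by (rule Cons.IH) (use Cons.prems in auto)
  have adj: "f (permute_list ?t zs) = - f zs"
    by (rule alternating_permute_adjacent[OF assms(1)]) (use Cons.prems in simp)
  have "f (permute_list (?t \<circ> ?q) zs) = f (permute_list ?q (permute_list ?t zs))"
    by (simp add: permute_list_compose[OF perm])
  also have "\<dots> = (if evenperm ?q then - f zs else f zs)"
    by (simp only: IH adj minus_minus)
  also have "evenperm (?t \<circ> ?q) = (evenperm ?t = evenperm ?q)"
    using perm t by (intro evenperm_comp) (auto intro: permutes_imp_permutation[rotated])
  then have "(if evenperm ?q then - f zs else f zs) = (if evenperm (?t \<circ> ?q) then f zs else - f zs)"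
    by (simp add: evenperm_swap)
  finally show ?case by (simp only: apply_adj_transps_Cons o_assoc Suc_eq_plus1)
qed

text \<open>\<open>permutes_induct\<close> builds a permutation from arbitrary transpositions; each
  of these is a product of adjacent ones, given by \<open>adj_transp_seq\<close>.\<close>

lemma alternating_permute:
  assumes "alternating f" "p permutes {..<length zs}"
  shows "f (permute_list p zs) = (if evenperm p then f zs else - f zs)"
proof -
  have "\<forall>zs'. length zs' = n \<longrightarrow> f (permute_list p zs') = (if evenperm p then f zs' else - f zs')"
    if "p permutes {..<n}" for n
    using that finite_lessThan
  proof (induction rule: permutes_induct)
    case id
    then show ?case by simp
  next
    case (swap a b p)
    have t: "Transposition.transpose a b = apply_adj_transps (adj_transp_seq (min a b) (max a b))"
      using swap.hyps by (subst adj_transp_seq_correct) (auto simp: min_def max_def transpose_commute)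
    have adj: "\<forall>i\<in>set (adj_transp_seq (min a b) (max a b)). Suc i < n"
      using swap.hyps by (subst set_adj_transp_seq) auto
    show ?case
      unfolding t
      by (intro allI impI alternating_permute_transpositions[OF assms(1)])
        (use swap adj in blast)+
  qed
  then show ?thesis using assms(2) by blast
qed

text \<open>\<open>D\<close> acts on the arguments of \<open>f\<close> by the Leibniz rule. With
  \<open>D = ad x\<close> this is the part of the Lie derivative that comes from the
  arguments.\<close>

primrec derivation :: "('x \<Rightarrow> 'x) \<Rightarrow> ('x list \<Rightarrow> 'b::ab_group_add) \<Rightarrow> 'x list \<Rightarrow> 'b" where
  "derivation D f [] = 0"
| "derivation D f (x # xs) = f (D x # xs) + derivation D (\<lambda>ys. f (x # ys)) xs"

lemma derivation_minus: "derivation D (\<lambda>xs. - f xs) xs = - derivation D f xs"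
  by (induction xs arbitrary: f) simp_all

lemma derivation_swap:
  assumes "alternating f"
  shows "derivation D f (xs @ x # y # ys) = - derivation D f (xs @ y # x # ys)"
  using assms
proof (induction xs arbitrary: f)
  case Nil
  have "(\<lambda>zs. f (x # y # zs)) = (\<lambda>zs. - f (y # x # zs))"
    by (intro ext) (rule alternating_swap[OF Nil])
  then have "derivation D (\<lambda>zs. f (x # y # zs)) ys = - derivation D (\<lambda>zs. f (y # x # zs)) ys"
    by (simp only: derivation_minus)
  then show ?case
    using alternating_swap[OF Nil, of "D x" y ys] alternating_swap[OF Nil, of x "D y" ys]
    by simp
next
  case (Cons z xs)
  show ?case
    using Cons.IH[OF alternating_Cons[OF Cons.prems], of z]
      alternatingD[OF Cons.prems, of "D z # xs" x y ys] by simp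
qed

text \<open>Bringing the changed entry from position i to the front costs \<open>(-1)^i\<close>. The
  result has the shape of the bracket terms in \<open>differential\<close>, which is how the two are
  matched.\<close>

lemma derivation_alternating:
  assumes "alternating f"
  shows "derivation D f xs =
    (\<Sum>i<length xs. if even i then f (D (xs ! i) # nths xs (- {i})) else - f (D (xs ! i) # nths xs (- {i})))"
  using assms
proof (induction xs arbitrary: f)
  case Nil
  then show ?case by simp
next
  case (Cons x xs)
  have "nths (x # xs) (- {0}) = xs"
    by (auto simp: nths_Cons intro!: nths_all)
  moreover have "nths (x # xs) (- {Suc i}) = x # nths xs (- {i})" for i
    by (simp add: nths_Cons Compl_eq)
  moreover have "derivation D (\<lambda>ys. f (x # ys)) xs =
    (\<Sum>i<length xs. if odd i then f (D (xs ! i) # x # nths xs (- {i}))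
       else - f (D (xs ! i) # x # nths xs (- {i})))"
    unfolding Cons.IH[OF alternating_Cons[OF Cons.prems]]
    by (rule sum.cong) (simp_all add: alternating_swap[OF Cons.prems, of x "D (xs ! i)" for i])
  ultimately show ?case
    by (simp add: sum.lessThan_Suc_shift del: sum.lessThan_Suc cong: if_cong)
qed

section \<open>The basic complex\<close>

context conformal_module
begin

lemma act_0_right [simp]: "act l a 0 = 0"
  using act_add_right[of l a 0 0] by simp

lemma act_minus_right [simp]: "act l a (- v) = - act l a v"
  by (metis act_0_right act_add_right add.right_inverse add_eq_0_iff)

lemma bracket_scale_poly_left: "bracket l (scaleA p a) b = scaleA [:poly p (- l):] (bracket l a b)"
proof (induction p)
  case 0
  then show ?case using bracket_add_left[of l 0 0 b] by simp
next
  case (pCons c p)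
  have "scaleA (pCons c p) a = scaleA [:c:] a + scaleA [:0, 1:] (scaleA p a)"
    by (simp add: mult.commute flip: A.scale_left_distrib)
  then have "bracket l (scaleA (pCons c p) a) b =
      scaleA [:c:] (bracket l a b) + scaleA [:- l:] (scaleA [:poly p (- l):] (bracket l a b))"
    by (simp only: bracket_add_left bracket_scale_left bracket_del_left pCons.IH)
  then show ?case
    by (simp add: mult.commute flip: A.scale_left_distrib)
qed

lemma act_scale_poly_left: "act l (scaleA p a) v = scaleV [:poly p (- l):] (act l a v)"
proof (induction p)
  case 0
  then show ?case using act_add_left[of l 0 0 v] by simp
next
  case (pCons c p)
  have "scaleA (pCons c p) a = scaleA [:c:] a + scaleA [:0, 1:] (scaleA p a)"
    by (simp add: mult.commute flip: A.scale_left_distrib)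
  then have "act l (scaleA (pCons c p) a) v =
      scaleV [:c:] (act l a v) + scaleV [:- l:] (scaleV [:poly p (- l):] (act l a v))"
    by (simp only: act_add_left act_scale_left act_del_left pCons.IH)
  then show ?case
    by (simp add: mult.commute flip: V.scale_left_distrib)
qed

lemma act_scale_poly_right: "act l a (scaleV [:s, 1:] v) = scaleV [:l + s, 1:] (act l a v)"
proof -
  have "[:s, 1:] = [:s:] + [:0, 1:]" "[:l + s, 1:] = [:s:] + [:l, 1:]"
    by simp_all
  then show ?thesis
    by (simp only: V.scale_left_distrib act_add_right act_scale_right act_del_right)
qed

lemma scaleV_sign: "scaleV ((- 1) ^ i) v = (if even i then v else - v)"
  by simp

text \<open>For an alternating function it suffices to impose sesquilinearity in the first entry.\<close>

definition sesquilinear :: "(('a \<times> complex) list \<Rightarrow> 'v) \<Rightarrow> bool" where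
  "sesquilinear f \<longleftrightarrow>
     (\<forall>a b l ys. f ((a + b, l) # ys) = f ((a, l) # ys) + f ((b, l) # ys)) \<and>
     (\<forall>p a l ys. f ((scaleA p a, l) # ys) = scaleV [:poly p (- l):] (f ((a, l) # ys)))"

abbreviation cochain_like :: "(('a \<times> complex) list \<Rightarrow> 'v) \<Rightarrow> bool" where
  "cochain_like f \<equiv> alternating f \<and> sesquilinear f"

lemma sesquilinear_add: "sesquilinear f \<Longrightarrow> f ((a + b, l) # ys) = f ((a, l) # ys) + f ((b, l) # ys)"
  unfolding sesquilinear_def by blast

lemma sesquilinear_scale:
  "sesquilinear f \<Longrightarrow> f ((scaleA p a, l) # ys) = scaleV [:poly p (- l):] (f ((a, l) # ys))"
  unfolding sesquilinear_def by blast

lemma sesquilinear_0: "sesquilinear f \<Longrightarrow> f ((0, l) # ys) = 0"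
  using sesquilinear_add[of f 0 0 l ys] by simp

lemma sesquilinear_minus: "sesquilinear f \<Longrightarrow> f ((- a, l) # ys) = - f ((a, l) # ys)"
  using sesquilinear_add[of f a "- a" l ys] sesquilinear_0[of f l ys]
  by (simp add: eq_neg_iff_add_eq_0 add.commute)

lemma sesquilinear_sum:
  "sesquilinear f \<Longrightarrow> f ((sum g S, l) # ys) = (\<Sum>s\<in>S. f ((g s, l) # ys))"
  by (induction S rule: infinite_finite_induct) (simp_all add: sesquilinear_0 sesquilinear_add)

lemma cochain_like_add:
  assumes "cochain_like f"
  shows "f (xs @ (a + b, l) # ys) = f (xs @ (a, l) # ys) + f (xs @ (b, l) # ys)"
  using assms by (simp add: alternating_move[of f xs] sesquilinear_add)

lemma cochain_like_scale:
  assumes "cochain_like f"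
  shows "f (xs @ (scaleA p a, l) # ys) = scaleV [:poly p (- l):] (f (xs @ (a, l) # ys))"
  using assms by (simp add: alternating_move[of f xs] sesquilinear_scale)

lemma cochain_like_Cons:
  assumes "cochain_like f"
  shows "cochain_like (\<lambda>ys. f (x # ys))"
proof (intro conjI)
  show "alternating (\<lambda>ys. f (x # ys))"
    using assms by (blast intro: alternating_Cons)
  show "sesquilinear (\<lambda>ys. f (x # ys))"
    unfolding sesquilinear_def
    using cochain_like_add[OF assms, of "[x]"] cochain_like_scale[OF assms, of "[x]"] by simp
qed

text \<open>Separates the algebraic part \<open>cochain_like\<close>, which mentions no degree and
  so survives induction on lists, from support in one length and from polynomiality. Adjacent swaps
  generate all permutations, and constants together with \<partial> generate
  \<open>\<complex>[\<partial>]\<close>, so both sides impose the same conditions.\<close>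

lemma mem_cochains_iff:
  "f \<in> cochains n \<longleftrightarrow>
     (\<forall>xs. length xs \<noteq> n \<longrightarrow> f xs = 0) \<and> cochain_like f \<and>
     (\<forall>as. length as = n \<longrightarrow> polynomial_fun n (\<lambda>ls. f (zip as ls)))"
  (is "_ \<longleftrightarrow> ?R")
proof
  assume f: "f \<in> cochains n"
  have "alternating f"
    unfolding alternating_def
  proof (intro allI)
    fix xs ys :: "('a \<times> complex) list" and x y
    let ?t = "Transposition.transpose (length xs) (Suc (length xs))"
    have "f (permute_list ?t (xs @ y # x # ys)) = scaleV (of_int (sign ?t)) (f (xs @ y # x # ys))"
    proof -
      have "?t permutes {..<length (xs @ y # x # ys)}"
        by (intro permutes_swap_id) auto
      then show ?thesis using f unfolding cochains_def by blast
    qed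
    then show "f (xs @ x # y # ys) = - f (xs @ y # x # ys)"
      by (simp add: permute_list_adjacent sign_swap_id)
  qed
  moreover have
      "\<forall>xs a b l ys. f (xs @ (a + b, l) # ys) = f (xs @ (a, l) # ys) + f (xs @ (b, l) # ys)"
      "\<forall>xs c a l ys. f (xs @ (scaleA [:c:] a, l) # ys) = scaleV [:c:] (f (xs @ (a, l) # ys))"
      "\<forall>xs a l ys. f (xs @ (scaleA [:0, 1:] a, l) # ys) = scaleV [:- l:] (f (xs @ (a, l) # ys))"
    using f unfolding cochains_def by blast+
  note this[THEN spec[of _ "[]"], unfolded append_Nil]
  then have add: "f ((a + b, l) # ys) = f ((a, l) # ys) + f ((b, l) # ys)"
    and const: "f ((scaleA [:c:] a, l) # ys) = scaleV [:c:] (f ((a, l) # ys))"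
    and del: "f ((scaleA [:0, 1:] a, l) # ys) = scaleV [:- l:] (f ((a, l) # ys))" for a b l ys c
    by blast+
  have "f ((scaleA p a, l) # ys) = scaleV [:poly p (- l):] (f ((a, l) # ys))" for p a l ys
  proof (induction p)
    case 0
    then show ?case using add[of 0 0] by simp
  next
    case (pCons c p)
    have "scaleA (pCons c p) a = scaleA [:c:] a + scaleA [:0, 1:] (scaleA p a)"
      by (simp add: mult.commute flip: A.scale_left_distrib)
    then have "f ((scaleA (pCons c p) a, l) # ys) =
        scaleV [:c:] (f ((a, l) # ys)) + scaleV [:- l:] (scaleV [:poly p (- l):] (f ((a, l) # ys)))"
      by (simp only: add const del pCons.IH)
    then show ?case
      by (simp add: mult.commute flip: V.scale_left_distrib)
  qed
  ultimately show ?R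
    using f add unfolding cochains_def sesquilinear_def by blast
next
  assume R: ?R
  then have cl: "cochain_like f" by blast
  have "f (permute_list p xs) = scaleV (of_int (sign p)) (f xs)"
    if "p permutes {..<length xs}" for p xs
    using alternating_permute[of f p xs] cl that by (simp add: sign_def)
  then show "f \<in> cochains n"
    using R cochain_like_add[OF cl] cochain_like_scale[OF cl] unfolding cochains_def by simp
qed

lemma cochainsD: "f \<in> cochains n \<Longrightarrow> cochain_like f"
  by (simp add: mem_cochains_iff)

section \<open>Cartan's formula\<close>

text \<open>The \<lambda>-bracket together with its spectral parameter: the bracket at the first
  \<lambda> is an argument that carries the sum of both. The bracket terms of the differential thus
  read \<open>f (ad x y # zs)\<close>.\<close>

definition ad :: "'a \<times> complex \<Rightarrow> 'a \<times> complex \<Rightarrow> 'a \<times> complex" where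
  "ad x y = (bracket (snd x) (fst x) (fst y), snd x + snd y)"

lemma differential_Nil [simp]: "differential f [] = 0"
  by (simp add: differential_def)

text \<open>
  With \<open>\<iota>\<^sub>x f = f (x # _)\<close> this is \<open>\<iota>\<^sub>x \<circ> d + d \<circ> \<iota>\<^sub>x = L\<^sub>x\<close>; it determines \<open>d\<close> by recursion on the list.
\<close>

lemma differential_Cons:
  assumes "alternating f"
  shows "differential f (x # xs) =
    act (snd x) (fst x) (f xs) - derivation (ad x) f xs - differential (\<lambda>ys. f (x # ys)) xs"
proof -
  let ?n = "length xs"
  have n0: "nths (x # xs) (- {0}) = xs" "nths (x # xs) (- {0, Suc j}) = nths xs (- {j})" for j
    by (auto simp: nths_Cons Compl_eq intro!: nths_all)
  have n1: "nths (x # xs) (- {Suc i}) = x # nths xs (- {i})"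
    "nths (x # xs) (- {Suc i, Suc j}) = x # nths xs (- {i, j})" for i j
    by (simp_all add: nths_Cons Compl_eq)
  have sgn: "scaleV ((- 1) ^ Suc i) v = - scaleV ((- 1) ^ i) v" for i v
    by simp
  have "(\<Sum>i<length (x # xs). scaleV ((- 1) ^ i)
          (act (snd ((x # xs) ! i)) (fst ((x # xs) ! i)) (f (nths (x # xs) (- {i}))))) =
      act (snd x) (fst x) (f xs) -
        (\<Sum>i<?n. scaleV ((- 1) ^ i) (act (snd (xs ! i)) (fst (xs ! i)) (f (x # nths xs (- {i})))))"
    unfolding length_Cons sum.lessThan_Suc_shift
    by (simp only: n0 n1 sgn nth_Cons_0 nth_Cons_Suc sum_negf power_0 V.scale_one diff_conv_add_uminus)
  \<comment> \<open>The pairs that involve position 0 make up the derivation term. In the other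
    pairs \<open>x\<close> stands behind the bracket, and moving it to the front produces the minus
    sign of the contracted differential.\<close>
  moreover have "(\<Sum>j<length (x # xs). \<Sum>i<j. scaleV ((- 1) ^ (i + j))
          (f (ad ((x # xs) ! i) ((x # xs) ! j) # nths (x # xs) (- {i, j})))) =
      - derivation (ad x) f xs - (\<Sum>j<?n. \<Sum>i<j. scaleV ((- 1) ^ (i + j))
          (f (x # ad (xs ! i) (xs ! j) # nths xs (- {i, j}))))"
  proof -
    have "f (ad y z # x # zs) = - f (x # ad y z # zs)" for y z zs
      by (rule alternating_swap[OF assms])
    then have swap: "scaleV ((- 1) ^ (Suc i + Suc j)) (f (ad y z # x # zs)) =
        - scaleV ((- 1) ^ (i + j)) (f (x # ad y z # zs))" for i j y z zs
      by simp
    have "(\<Sum>j<?n. scaleV ((- 1) ^ (0 + Suc j)) (f (ad x (xs ! j) # nths xs (- {j})))) =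
        - derivation (ad x) f xs"
      unfolding derivation_alternating[OF assms] scaleV_sign sum_negf[symmetric]
      by (rule sum.cong) simp_all
    then show ?thesis
      unfolding length_Cons sum.lessThan_Suc_shift
      by (simp only: n0 n1 swap nth_Cons_0 nth_Cons_Suc sum.distrib sum_negf
          diff_conv_add_uminus lessThan_0 sum.empty add_0_left)
  qed
  ultimately show ?thesis
    unfolding differential_def ad_def[symmetric] by (simp add: algebra_simps)
qed

lemma differential_add:
  "differential (\<lambda>xs. f xs + g xs) xs = differential f xs + differential g xs"
  by (simp add: differential_def act_add_right V.scale_right_distrib sum.distrib)

lemma differential_minus: "differential (\<lambda>xs. - f xs) xs = - differential f xs"
  by (simp add: differential_def sum_negf)

lemma differential_scale:
  "differential (\<lambda>xs. scaleV [:c:] (f xs)) xs = scaleV [:c:] (differential f xs)"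
  by (simp add: differential_def act_scale_right V.scale_right_distrib V.scale_sum_right mult.commute)

text \<open>Omitting one entry and replacing two entries by their bracket both shorten the list by
  exactly one; on the empty list both sums are empty.\<close>

lemma differential_eq_0:
  assumes "\<And>ys. Suc (length ys) = length xs \<Longrightarrow> f ys = 0"
  shows "differential f xs = 0"
proof -
  have "f (nths xs (- {i})) = 0" if "i < length xs" for i
  proof (rule assms)
    have "{j. j < length xs \<and> j \<in> - {i}} = {..<length xs} - {i}" by auto
    then show "Suc (length (nths xs (- {i}))) = length xs"
      using that by (simp add: length_nths)
  qed
  moreover have "f (x # nths xs (- {i, j})) = 0" if "i < j" "j < length xs" for i j x
  proof (rule assms)
    have "{k. k < length xs \<and> k \<in> - {i, j}} = {..<length xs} - {i, j}" by auto
    then show "Suc (length (x # nths xs (- {i, j}))) = length xs"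
      using that by (simp add: length_nths card_Diff_subset)
  qed
  ultimately show ?thesis
    by (simp add: differential_def)
qed

text \<open>Skew-symmetry of the bracket substitutes -l - \<partial> for the parameter. In the first
  entry of \<open>f\<close>, which carries l + m, sesquilinearity turns \<partial> into -(l + m), so
  the substituted value becomes m, the parameter of the opposite bracket.\<close>

lemma bracket_skew:
  assumes "cochain_like f"
  shows "f (ad x y # zs) = - f (ad y x # zs)"
proof -
  obtain a l b m where xy: "x = (a, l)" "y = (b, m)" by fastforce
  obtain p where p: "\<And>l'. bracket l' b a = poly_subst scaleA [:l':] p"
    using bracket_polynomial by blast
  have f: "f ((poly_subst scaleA r p, l + m) # zs) =
      (\<Sum>k\<le>degree p. scaleV [:poly r (- (l + m)) ^ k:] (f ((coeff p k, l + m) # zs)))" for r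
    unfolding poly_subst_def using assms by (simp add: sesquilinear_sum sesquilinear_scale)
  have "f (ad x y # zs) = - f ((poly_subst scaleA [:- l, - 1:] p, l + m) # zs)"
    using assms by (simp add: ad_def xy skew_symmetry[OF p] sesquilinear_minus)
  also have "f ((poly_subst scaleA [:- l, - 1:] p, l + m) # zs) = f (ad y x # zs)"
    by (simp add: ad_def xy p f add.commute)
  finally show ?thesis .
qed

text \<open>For a swap at the front, \<open>differential_Cons\<close> is unfolded twice: the action
  and derivation terms of \<open>x\<close> and \<open>y\<close> trade places with opposite signs,
  the single term \<open>f (ad x y # ys)\<close> is handled by \<open>bracket_skew\<close>, and the
  doubly contracted differential by alternation of \<open>f\<close>. A longer prefix is peeled off
  by one unfolding.\<close>

lemma alternating_differential:
  assumes "cochain_like f"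
  shows "alternating (differential f)"
proof -
  have "differential f (xs @ x # y # ys) = - differential f (xs @ y # x # ys)"
    if "cochain_like f" for xs x y ys and f :: "('a \<times> complex) list \<Rightarrow> 'v"
    using that
  proof (induction xs arbitrary: f)
    case Nil
    then have alt: "alternating f" "alternating (\<lambda>zs. f (z # zs))" for z
      by (auto intro: alternating_Cons)
    have "(\<lambda>zs. f (x # y # zs)) = (\<lambda>zs. - f (y # x # zs))"
      by (intro ext) (rule alternating_swap[OF alt(1)])
    then have "differential (\<lambda>zs. f (x # y # zs)) ys = - differential (\<lambda>zs. f (y # x # zs)) ys"
      by (simp only: differential_minus)
    then show ?case
      using bracket_skew[OF Nil, of x y ys]
      by (simp add: differential_Cons alt)
  next
    case (Cons z xs)
    then have alt: "alternating f" by blast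
    have "f (xs @ x # y # ys) = - f (xs @ y # x # ys)"
      by (rule alternatingD[OF alt])
    moreover have "derivation (ad z) f (xs @ x # y # ys) = - derivation (ad z) f (xs @ y # x # ys)"
      by (rule derivation_swap[OF alt])
    ultimately show ?case
      using Cons.IH[OF cochain_like_Cons[OF Cons.prems], of z]
      by (simp add: differential_Cons alt)
  qed
  then show ?thesis
    using assms unfolding alternating_def by blast
qed

lemma derivation_ad_add:
  assumes "cochain_like f"
  shows "derivation (ad (a + b, l)) f ys = derivation (ad (a, l)) f ys + derivation (ad (b, l)) f ys"
  using assms
proof (induction ys arbitrary: f)
  case (Cons y ys)
  then show ?case
    using Cons.IH[OF cochain_like_Cons[OF Cons.prems], of y]
    by (simp add: ad_def bracket_add_left sesquilinear_add)
qed simp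

lemma derivation_ad_scale:
  assumes "cochain_like f"
  shows "derivation (ad (scaleA p a, l)) f ys = scaleV [:poly p (- l):] (derivation (ad (a, l)) f ys)"
  using assms
proof (induction ys arbitrary: f)
  case (Cons y ys)
  then show ?case
    using Cons.IH[OF cochain_like_Cons[OF Cons.prems], of y]
    by (simp add: ad_def bracket_scale_poly_left sesquilinear_scale V.scale_right_distrib)
qed simp

text \<open>Once d f alternates, only its first entry has to be examined, and each of the three
  terms of the recursion is visibly sesquilinear there.\<close>

lemma cochain_like_differential:
  assumes "cochain_like f"
  shows "cochain_like (differential f)"
proof (intro conjI alternating_differential[OF assms])
  have alt: "alternating f" and sesq: "sesquilinear f" using assms by blast+
  show "sesquilinear (differential f)"
    unfolding sesquilinear_def
    by (simp add: differential_Cons[OF alt] act_add_left act_scale_poly_left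
        derivation_ad_add[OF assms] derivation_ad_scale[OF assms]
        sesquilinear_add[OF sesq] sesquilinear_scale[OF sesq]
        differential_add differential_scale V.scale_right_diff_distrib)
qed

subsection \<open>The operator \<open>\<partial>\<close> and the homotopy formula\<close>

text \<open>\<open>ad x\<close> raises the \<lambda> of the entry it changes by
  \<open>snd x\<close>, hence the extra summand. The offset \<open>s\<close> collects the
  \<lambda>'s of entries already contracted, without which the induction would not close.\<close>

lemma derivation_shift:
  "derivation (ad x) (\<lambda>xs. scaleV [:s + sum_list (map snd xs), 1:] (f xs)) xs =
     scaleV [:s + snd x + sum_list (map snd xs), 1:] (derivation (ad x) f xs)"
proof (induction xs arbitrary: f s)
  case (Cons y xs)
  then show ?case
    using Cons.IH[of "s + snd y" "\<lambda>ys. f (y # ys)"]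
    by (simp add: ad_def V.scale_right_distrib ac_simps)
qed simp

lemma alternating_shift:
  assumes "alternating f"
  shows "alternating (\<lambda>xs. scaleV [:s + sum_list (map snd xs), 1:] (f xs))"
  unfolding alternating_def
proof (intro allI)
  fix xs x y ys
  show "scaleV [:s + sum_list (map snd (xs @ x # y # ys)), 1:] (f (xs @ x # y # ys)) =
      - scaleV [:s + sum_list (map snd (xs @ y # x # ys)), 1:] (f (xs @ y # x # ys))"
    using alternatingD[OF assms, of xs x y ys] by (simp add: ac_simps)
qed

text \<open>All three terms of the recursion acquire the same factor: the action at \<lambda> shifts
  \<partial> by \<lambda>, the derivation shifts by \<lambda> too, and contraction moves \<lambda>
  into the offset.\<close>

lemma differential_shift:
  assumes "alternating f"
  shows "differential (\<lambda>xs. scaleV [:s + sum_list (map snd xs), 1:] (f xs)) xs =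
     scaleV [:s + sum_list (map snd xs), 1:] (differential f xs)"
  using assms
proof (induction xs arbitrary: f s)
  case (Cons x xs)
  show ?case
    using Cons.IH[OF alternating_Cons[OF Cons.prems], of "s + snd x" x]
    by (simp add: differential_Cons[OF alternating_shift[OF Cons.prems]]
        differential_Cons[OF Cons.prems] derivation_shift act_scale_poly_right
        V.scale_right_diff_distrib ac_simps)
qed simp

lemma differential_del_cochain:
  "alternating f \<Longrightarrow> differential (del_cochain f) = del_cochain (differential f)"
  using differential_shift[of f 0] by (simp add: del_cochain_def[abs_def] fun_eq_iff)

lemma cochain_like_del_cochain:
  assumes "cochain_like f"
  shows "cochain_like (del_cochain f)"
  using assms alternating_shift[of f 0]
  by (simp add: del_cochain_def[abs_def] sesquilinear_def V.scale_right_distrib mult.commute)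

text \<open>\<open>ad (e, 0)\<close> leaves every \<lambda> unchanged and applies \<partial> to the
  entry, which sesquilinearity turns into multiplication by the negative of that entry's
  \<lambda>.\<close>

lemma derivation_del:
  assumes "cochain_like f" "\<And>a. bracket 0 e a = scaleA [:0, 1:] a"
  shows "derivation (ad (e, 0)) f xs = - scaleV [:sum_list (map snd xs):] (f xs)"
  using assms(1)
proof (induction xs arbitrary: f)
  case (Cons y xs)
  obtain a l where y: "y = (a, l)" by fastforce
  have "ad (e, 0) (a, l) = (scaleA [:0, 1:] a, l)"
    by (simp add: ad_def assms(2))
  then have "derivation (ad (e, 0)) f (y # xs) =
      - scaleV [:l:] (f (y # xs)) - scaleV [:sum_list (map snd xs):] (f (y # xs))"
    using Cons.IH[OF cochain_like_Cons[OF Cons.prems], of y] Cons.prems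
    by (simp add: y sesquilinear_scale flip: V.scale_minus_left)
  also have "\<dots> = - scaleV ([:l:] + [:sum_list (map snd xs):]) (f (y # xs))"
    by (simp only: V.scale_left_distrib minus_add_distrib diff_conv_add_uminus)
  finally show ?case by (simp add: y)
qed simp

text \<open>The action contributes \<beta> + \<partial> and the subtracted derivation contributes
  the sum of the \<lambda>'s; regrouped, these are \<beta> and the operator
  \<open>del_cochain\<close>.\<close>

lemma homotopy:
  assumes f: "cochain_like f"
    and e: "\<And>a. bracket 0 e a = scaleA [:0, 1:] a" "\<And>v. act 0 e v = scaleV [:\<beta>, 1:] v"
  shows "differential f ((e, 0) # xs) + differential (\<lambda>ys. f ((e, 0) # ys)) xs =
    scaleV [:\<beta>:] (f xs) + del_cochain f xs"
proof -
  have "[:\<beta>:] + [:sum_list (map snd xs), 1:] = [:\<beta>, 1:] + [:sum_list (map snd xs):]" by simp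
  then have "scaleV [:\<beta>:] (f xs) + scaleV [:sum_list (map snd xs), 1:] (f xs) =
      scaleV [:\<beta>, 1:] (f xs) + scaleV [:sum_list (map snd xs):] (f xs)"
    by (simp only: V.scale_left_distrib[symmetric])
  then show ?thesis
    using f by (simp add: differential_Cons derivation_del[OF f e(1)] e(2) del_cochain_def)
qed

section \<open>Polynomiality\<close>

text \<open>An inductive form of \<open>polynomial_fun\<close>: substitutions and actions can be
  pushed through by rule induction, without handling exponents. Only lists of length n matter, hence
  \<open>eq_on\<close>.\<close>

inductive poly_map :: "nat \<Rightarrow> (complex list \<Rightarrow> 'v) \<Rightarrow> bool" for n where
  const: "poly_map n (\<lambda>_. v)"
| add: "poly_map n f \<Longrightarrow> poly_map n g \<Longrightarrow> poly_map n (\<lambda>ls. f ls + g ls)"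
| var: "poly_map n f \<Longrightarrow> i < n \<Longrightarrow> poly_map n (\<lambda>ls. scaleV [:ls ! i:] (f ls))"
| eq_on: "poly_map n f \<Longrightarrow> (\<And>ls. length ls = n \<Longrightarrow> f ls = g ls) \<Longrightarrow> poly_map n g"

text \<open>Scalar polynomials are described as multipliers of \<open>poly_map\<close>, so that a
  product of scalars is a composition of two multiplications.\<close>

definition poly_scalar :: "nat \<Rightarrow> (complex list \<Rightarrow> complex) \<Rightarrow> bool" where
  "poly_scalar n r \<longleftrightarrow> (\<forall>f. poly_map n f \<longrightarrow> poly_map n (\<lambda>ls. scaleV [:r ls:] (f ls)))"

lemma poly_map_sum:
  "(\<And>s. s \<in> S \<Longrightarrow> poly_map n (f s)) \<Longrightarrow> poly_map n (\<lambda>ls. \<Sum>s\<in>S. f s ls)"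
  by (induction S rule: infinite_finite_induct) (simp_all add: poly_map.const poly_map.add)

lemma poly_map_scale: "poly_map n f \<Longrightarrow> poly_map n (\<lambda>ls. scaleV p (f ls))"
proof (induction rule: poly_map.induct)
  case (var f i)
  have "scaleV p (scaleV [:ls ! i:] (f ls)) = scaleV [:ls ! i:] (scaleV p (f ls))" for ls
    by (rule V.scale_left_commute)
  with var show ?case by (simp only: poly_map.var)
next
  case (eq_on f g)
  then show ?case by (auto intro: poly_map.eq_on[OF eq_on.IH])
qed (simp_all only: V.scale_right_distrib poly_map.const poly_map.add)

lemma poly_map_scalar: "poly_scalar n r \<Longrightarrow> poly_map n f \<Longrightarrow> poly_map n (\<lambda>ls. scaleV [:r ls:] (f ls))"
  unfolding poly_scalar_def by blast

lemma poly_scalar_const: "poly_scalar n (\<lambda>_. c)"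
  unfolding poly_scalar_def by (blast intro: poly_map_scale)

lemma poly_scalar_var: "i < n \<Longrightarrow> poly_scalar n (\<lambda>ls. ls ! i)"
  unfolding poly_scalar_def by (blast intro: poly_map.var)

lemma poly_scalar_add:
  assumes "poly_scalar n r" "poly_scalar n s"
  shows "poly_scalar n (\<lambda>ls. r ls + s ls)"
proof -
  have "[:x + y:] = [:x:] + [:y:]" for x y :: complex by simp
  then have eq: "scaleV [:r ls + s ls:] v = scaleV [:r ls:] v + scaleV [:s ls:] v" for ls v
    by (simp only: V.scale_left_distrib)
  show ?thesis
    unfolding poly_scalar_def eq
    by (intro allI impI poly_map.add poly_map_scalar[OF assms(1)] poly_map_scalar[OF assms(2)])
qed

lemma poly_scalar_mult:
  assumes "poly_scalar n r" "poly_scalar n s"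
  shows "poly_scalar n (\<lambda>ls. r ls * s ls)"
proof -
  have eq: "scaleV [:x * y:] v = scaleV [:x:] (scaleV [:y:] v)" for x y v
    by (simp add: mult.commute)
  show ?thesis
    unfolding poly_scalar_def eq
    by (intro allI impI poly_map_scalar[OF assms(1)] poly_map_scalar[OF assms(2)])
qed

lemma poly_scalar_power: "poly_scalar n r \<Longrightarrow> poly_scalar n (\<lambda>ls. r ls ^ k)"
  by (induction k) (simp_all add: poly_scalar_const poly_scalar_mult)

lemma poly_scalar_sum:
  "(\<And>s. s \<in> S \<Longrightarrow> poly_scalar n (r s)) \<Longrightarrow> poly_scalar n (\<lambda>ls. \<Sum>s\<in>S. r s ls)"
  by (induction S rule: infinite_finite_induct) (simp_all add: poly_scalar_const poly_scalar_add)

lemma poly_scalar_prod: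
  "(\<And>s. s \<in> S \<Longrightarrow> poly_scalar n (r s)) \<Longrightarrow> poly_scalar n (\<lambda>ls. \<Prod>s\<in>S. r s ls)"
  by (induction S rule: infinite_finite_induct) (simp_all add: poly_scalar_const poly_scalar_mult)

text \<open>Polynomials may be substituted for variables. This covers an omitted variable, a sum of
  two variables, and a constant in place of the first variable.\<close>

lemma poly_map_subst:
  assumes "poly_map m f"
    and "\<And>ls. length ls = n \<Longrightarrow> length (g ls) = m"
    and "\<And>i. i < m \<Longrightarrow> poly_scalar n (\<lambda>ls. g ls ! i)"
  shows "poly_map n (\<lambda>ls. f (g ls))"
  using assms(1)
proof (induction rule: poly_map.induct)
  case (const v)
  show ?case by (rule poly_map.const)
next
  case (add f h)
  show ?case by (rule poly_map.add[OF add.IH])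
next
  case (var f i)
  show ?case by (rule poly_map_scalar[OF assms(3)[OF var.hyps(2)] var.IH])
next
  case (eq_on f h)
  show ?case by (rule poly_map.eq_on[OF eq_on.IH]) (simp add: eq_on.hyps(2) assms(2))
qed

text \<open>The axiom on polynomiality covers a fixed vector; sums and variable factors pass through
  because the action is linear over \<complex> in the vector.\<close>

lemma poly_map_act:
  assumes "poly_scalar n r" "poly_map n f"
  shows "poly_map n (\<lambda>ls. act (r ls) a (f ls))"
  using assms(2)
proof (induction rule: poly_map.induct)
  case (const v)
  obtain p where "\<And>l. act l a v = poly_subst scaleV [:l:] p"
    using act_polynomial by blast
  then have "(\<lambda>ls. act (r ls) a v) = (\<lambda>ls. \<Sum>k\<le>degree p. scaleV [:r ls ^ k:] (coeff p k))"
    by (simp add: poly_subst_def poly_const_pow)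
  then show ?case
    using assms(1)
    by (simp only:) (intro poly_map_sum poly_map_scalar poly_scalar_power poly_map.const)
next
  case (eq_on f g)
  show ?case by (rule poly_map.eq_on[OF eq_on.IH]) (simp add: eq_on.hyps(2))
next
  case (add f h)
  then show ?case unfolding act_add_right by (intro poly_map.add)
next
  case (var f i)
  then show ?case unfolding act_scale_right by (intro poly_map.var)
qed

section \<open>Comparison with expansions in monomials\<close>

abbreviation monomial :: "nat \<Rightarrow> nat list \<Rightarrow> complex list \<Rightarrow> complex" where
  "monomial n e ls \<equiv> \<Prod>i<n. (ls ! i) ^ (e ! i)"

abbreviation exponents :: "nat \<Rightarrow> nat \<Rightarrow> nat list set" where
  "exponents n N \<equiv> {e. length e = n \<and> set e \<subseteq> {..N}}"

lemma finite_exponents: "finite (exponents n N)"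
  using finite_lists_length_eq[of "{..N}" n] by (simp add: conj_commute)

lemma polynomial_fun_monomial:
  assumes "length e = n"
  shows "polynomial_fun n (\<lambda>ls. scaleV [:monomial n e ls:] v)"
  unfolding polynomial_fun_def
proof (intro exI allI impI)
  fix ls
  have "e \<in> exponents n (sum_list e)"
    using assms by (auto simp: member_le_sum_list)
  then have "(\<Sum>e'\<in>exponents n (sum_list e). if e' = e then scaleV [:monomial n e' ls:] v else 0) =
      scaleV [:monomial n e ls:] v"
    by (subst sum.delta[OF finite_exponents]) simp
  then show "scaleV [:monomial n e ls:] v =
      (\<Sum>e'\<in>exponents n (sum_list e). scaleV [:monomial n e' ls:] (if e' = e then v else 0))"
    by (simp add: if_distrib cong: if_cong)
qed

text \<open>Padding with zero coefficients brings two expansions to a common degree bound, so that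
  they can be added.\<close>

lemma polynomial_fun_mono:
  assumes "N \<le> M"
  shows "(\<Sum>e\<in>exponents n N. scaleV [:monomial n e ls:] (c e)) =
    (\<Sum>e\<in>exponents n M. scaleV [:monomial n e ls:] (if set e \<subseteq> {..N} then c e else 0))"
  by (rule sum.mono_neutral_cong_left) (use assms finite_exponents in auto)

lemma polynomial_fun_add:
  assumes "polynomial_fun n f" "polynomial_fun n g"
  shows "polynomial_fun n (\<lambda>ls. f ls + g ls)"
proof -
  obtain N c where f: "\<And>ls. length ls = n \<Longrightarrow>
      f ls = (\<Sum>e\<in>exponents n N. scaleV [:monomial n e ls:] (c e))"
    using assms(1) unfolding polynomial_fun_def by blast
  obtain M d where g: "\<And>ls. length ls = n \<Longrightarrow>
      g ls = (\<Sum>e\<in>exponents n M. scaleV [:monomial n e ls:] (d e))"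
    using assms(2) unfolding polynomial_fun_def by blast
  show ?thesis
    unfolding polynomial_fun_def
  proof (intro exI allI impI)
    fix ls :: "complex list"
    assume ls: "length ls = n"
    show "f ls + g ls = (\<Sum>e\<in>exponents n (max N M). scaleV [:monomial n e ls:]
        ((if set e \<subseteq> {..N} then c e else 0) + (if set e \<subseteq> {..M} then d e else 0)))"
      unfolding f[OF ls] g[OF ls] V.scale_right_distrib sum.distrib
        polynomial_fun_mono[OF max.cobounded1[of N M]] polynomial_fun_mono[OF max.cobounded2[of M N]] ..
  qed
qed

lemma polynomial_fun_0: "polynomial_fun n (\<lambda>_. 0)"
  unfolding polynomial_fun_def by (intro exI[of _ 0] exI[of _ "\<lambda>_. 0"]) simp

lemma polynomial_fun_sum:
  "(\<And>s. s \<in> S \<Longrightarrow> polynomial_fun n (f s)) \<Longrightarrow> polynomial_fun n (\<lambda>ls. \<Sum>s\<in>S. f s ls)"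
  by (induction S rule: infinite_finite_induct) (simp_all add: polynomial_fun_0 polynomial_fun_add)

lemma polynomial_fun_cong:
  "polynomial_fun n f \<Longrightarrow> (\<And>ls. length ls = n \<Longrightarrow> f ls = g ls) \<Longrightarrow> polynomial_fun n g"
  by (simp add: polynomial_fun_def)

lemma monomial_Suc:
  assumes "i < n" "length e = n"
  shows "monomial n (e[i := Suc (e ! i)]) ls = ls ! i * monomial n e ls"
proof -
  have "(\<Prod>j\<in>{..<n} - {i}. (ls ! j) ^ (e[i := Suc (e ! i)] ! j)) = (\<Prod>j\<in>{..<n} - {i}. (ls ! j) ^ (e ! j))"
    by (rule prod.cong) auto
  then show ?thesis
    using assms by (simp add: prod.remove[of "{..<n}" i])
qed

lemma polynomial_fun_var:
  assumes "polynomial_fun n f" "i < n"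
  shows "polynomial_fun n (\<lambda>ls. scaleV [:ls ! i:] (f ls))"
proof -
  obtain N c where f: "\<And>ls. length ls = n \<Longrightarrow>
      f ls = (\<Sum>e\<in>exponents n N. scaleV [:monomial n e ls:] (c e))"
    using assms(1) unfolding polynomial_fun_def by blast
  have "polynomial_fun n (\<lambda>ls. \<Sum>e\<in>exponents n N. scaleV [:monomial n (e[i := Suc (e ! i)]) ls:] (c e))"
    by (intro polynomial_fun_sum polynomial_fun_monomial) simp
  then show ?thesis
  proof (rule polynomial_fun_cong)
    fix ls :: "complex list"
    assume "length ls = n"
    then show "(\<Sum>e\<in>exponents n N. scaleV [:monomial n (e[i := Suc (e ! i)]) ls:] (c e)) =
        scaleV [:ls ! i:] (f ls)"
      unfolding f[OF \<open>length ls = n\<close>] V.scale_sum_right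
      by (intro sum.cong) (simp_all add: monomial_Suc[OF assms(2)] mult.commute)
  qed
qed

lemma polynomial_fun_iff: "polynomial_fun n f \<longleftrightarrow> poly_map n f"
proof
  assume "polynomial_fun n f"
  then obtain N c where f: "\<And>ls. length ls = n \<Longrightarrow>
      f ls = (\<Sum>e\<in>exponents n N. scaleV [:monomial n e ls:] (c e))"
    unfolding polynomial_fun_def by blast
  have "poly_map n (\<lambda>ls. \<Sum>e\<in>exponents n N. scaleV [:monomial n e ls:] (c e))"
    by (intro poly_map_sum poly_map_scalar poly_scalar_prod poly_scalar_power poly_scalar_var poly_map.const)
      simp
  then show "poly_map n f"
    by (rule poly_map.eq_on) (simp add: f)
next
  assume "poly_map n f"
  then show "polynomial_fun n f"
  proof (induction rule: poly_map.induct)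
    case (const v)
    show ?case
      by (rule polynomial_fun_cong[OF polynomial_fun_monomial[of "replicate n 0" n v]])
        (simp_all flip: one_pCons)
  next
    case (eq_on f g)
    show ?case by (rule polynomial_fun_cong[OF eq_on.IH]) (rule eq_on.hyps(2))
  next
    case (add f g)
    show ?case by (rule polynomial_fun_add[OF add.IH])
  next
    case (var f i)
    show ?case by (rule polynomial_fun_var[OF var.IH var.hyps(2)])
  qed
qed

section \<open>Closure of the cochain spaces under the operators\<close>

lemma poly_scalar_nths:
  assumes "k < length (nths [0..<n] I)"
  shows "poly_scalar n (\<lambda>ls. nths ls I ! k)"
proof -
  \<comment> \<open>\<open>nths [0..<n] I ! k\<close> is the original index of the k-th variable
    that is kept.\<close>
  have eq: "nths ls I ! k = ls ! (nths [0..<n] I ! k)" if "length ls = n" for ls :: "complex list"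
  proof -
    have "nths ls I = map ((!) ls) (nths [0..<n] I)"
      unfolding nths_map[symmetric] that[symmetric] map_nth ..
    then show ?thesis using assms by simp
  qed
  have "nths [0..<n] I ! k < n"
    using nth_mem[OF assms] set_nths_subset[of "[0..<n]" I] by auto
  then have "poly_map n (\<lambda>ls. scaleV [:nths ls I ! k:] (f ls))" if "poly_map n f" for f
    by (rule poly_map.eq_on[OF poly_map.var[OF that]]) (simp add: eq)
  then show ?thesis
    unfolding poly_scalar_def by blast
qed

lemma nths_zip: "length xs = length ys \<Longrightarrow> nths (zip xs ys) I = zip (nths xs I) (nths ys I)"
  by (induction xs ys arbitrary: I rule: list_induct2) (simp_all add: nths_Cons)

lemma cochains_poly_map: "f \<in> cochains n \<Longrightarrow> length as = n \<Longrightarrow> poly_map n (\<lambda>ls. f (zip as ls))"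
  by (simp add: mem_cochains_iff polynomial_fun_iff)

lemma length_nths_compl:
  assumes "I \<subseteq> {..<length xs}"
  shows "length (nths xs (- I)) = length xs - card I"
proof -
  have "{i. i < length xs \<and> i \<in> - I} = {..<length xs} - I" by auto
  then show ?thesis
    using assms by (simp add: length_nths card_Diff_subset finite_subset)
qed

lemma poly_map_differential:
  assumes f: "f \<in> cochains n" and as: "length as = Suc n"
  shows "poly_map (Suc n) (\<lambda>ls. differential f (zip as ls))"
proof -
  have 1: "poly_map (Suc n) (\<lambda>ls. act (ls ! i) (as ! i) (f (zip (nths as (- {i})) (nths ls (- {i})))))"
    if "i < Suc n" for i
  proof (intro poly_map_act poly_scalar_var that poly_map_subst[OF cochains_poly_map[OF f]])
    show "length (nths as (- {i})) = n"
      using that as by (simp add: length_nths_compl)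
    show "length (nths ls (- {i})) = n" if "length ls = Suc n" for ls :: "complex list"
      using that \<open>i < Suc n\<close> by (simp add: length_nths_compl)
    show "poly_scalar (Suc n) (\<lambda>ls. nths ls (- {i}) ! k)" if "k < n" for k
      by (rule poly_scalar_nths) (use that \<open>i < Suc n\<close> in \<open>simp add: length_nths_compl del: upt_Suc\<close>)
  qed
  have 2: "poly_map (Suc n) (\<lambda>ls. f ((bracket (ls ! i) (as ! i) (as ! j), ls ! i + ls ! j) #
      zip (nths as (- {i, j})) (nths ls (- {i, j}))))"
    if "i < j" "j < Suc n" for i j
  proof -
    \<comment> \<open>The remaining list has \<open>1 + (Suc n - 2)\<close> entries; with truncated
      subtraction this equals n only for nonzero n, which two distinct positions below
      \<open>Suc n\<close> guarantee.\<close>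
    have ij: "{i, j} \<subseteq> {..<Suc n}" "card {i, j} = 2" and n: "n \<noteq> 0"
      using that by auto
    obtain p where p: "\<And>l. bracket l (as ! i) (as ! j) = poly_subst scaleA [:l:] p"
      using bracket_polynomial by blast
    \<comment> \<open>The bracket is expanded in powers of its parameter. These are complex scalars
      and leave \<open>f\<close> unchanged, so that \<open>f\<close> is evaluated at fixed
      coefficients.\<close>
    have "f ((bracket (ls ! i) (as ! i) (as ! j), m) # zs) =
        (\<Sum>k\<le>degree p. scaleV [:(ls ! i) ^ k:] (f ((coeff p k, m) # zs)))" for ls m zs
      unfolding p poly_subst_def
      using cochainsD[OF f] by (simp add: sesquilinear_sum sesquilinear_scale)
    moreover have "poly_map (Suc n) (\<lambda>ls. f (zip (c # nths as (- {i, j}))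
        ((ls ! i + ls ! j) # nths ls (- {i, j}))))" for c
    proof (rule poly_map_subst[OF cochains_poly_map[OF f]])
      show "length (c # nths as (- {i, j})) = n"
        using ij as n by (simp add: length_nths_compl)
      show "length ((ls ! i + ls ! j) # nths ls (- {i, j})) = n" if "length ls = Suc n" for ls
        using ij that n by (simp add: length_nths_compl)
      show "poly_scalar (Suc n) (\<lambda>ls. ((ls ! i + ls ! j) # nths ls (- {i, j})) ! k)" if "k < n" for k
      proof (cases k)
        case 0
        then show ?thesis
          using ij by (simp add: poly_scalar_add poly_scalar_var)
      next
        case (Suc k')
        have "k' < length (nths [0..<Suc n] (- {i, j}))"
          using Suc that ij by (simp add: length_nths_compl del: upt_Suc)
        then show ?thesis
          by (simp add: Suc poly_scalar_nths)
      qed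
    qed
    ultimately show ?thesis
      using that
      by (simp only: zip_Cons_Cons)
        (intro poly_map_sum poly_map_scalar poly_scalar_power poly_scalar_var; simp)
  qed
  have "poly_map (Suc n) (\<lambda>ls.
      (\<Sum>i<Suc n. scaleV ((- 1) ^ i) (act (ls ! i) (as ! i) (f (zip (nths as (- {i})) (nths ls (- {i})))))) +
      (\<Sum>j<Suc n. \<Sum>i<j. scaleV ((- 1) ^ (i + j))
        (f ((bracket (ls ! i) (as ! i) (as ! j), ls ! i + ls ! j) #
          zip (nths as (- {i, j})) (nths ls (- {i, j}))))))"
    by (intro poly_map.add poly_map_sum poly_map_scale 1 2) simp_all
  then show ?thesis
    by (rule poly_map.eq_on) (simp add: differential_def as nths_zip del: sum.lessThan_Suc)
qed

lemma differential_closed: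
  assumes "f \<in> cochains n"
  shows "differential f \<in> cochains (Suc n)"
proof -
  have "differential f xs = 0" if "length xs \<noteq> Suc n" for xs
    using that assms by (intro differential_eq_0) (auto simp: mem_cochains_iff)
  then show ?thesis
    using assms cochain_like_differential poly_map_differential
    by (auto simp: mem_cochains_iff polynomial_fun_iff)
qed

text \<open>Contraction substitutes the constant \<open>snd x\<close> for the first
  variable.\<close>

lemma Cons_closed:
  assumes "f \<in> cochains (Suc n)"
  shows "(\<lambda>ys. f (x # ys)) \<in> cochains n"
proof -
  have "poly_map n (\<lambda>ls. f (x # zip as ls))" if as: "length as = n" for as
  proof -
    have "poly_map n (\<lambda>ls. f (zip (fst x # as) (snd x # ls)))"
    proof (rule poly_map_subst[OF cochains_poly_map[OF assms]])
      show "poly_scalar n (\<lambda>ls. (snd x # ls) ! i)" if "i < Suc n" for i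
        using that by (cases i) (simp_all add: poly_scalar_const poly_scalar_var)
    qed (use as in auto)
    then show ?thesis by simp
  qed
  then show ?thesis
    using assms cochain_like_Cons by (auto simp: mem_cochains_iff polynomial_fun_iff)
qed

lemma del_cochain_closed:
  assumes "f \<in> cochains n"
  shows "del_cochain f \<in> cochains n"
proof -
  have "poly_map n (\<lambda>ls. del_cochain f (zip as ls))" if as: "length as = n" for as
  proof -
    have "poly_map n (\<lambda>ls. scaleV [:\<Sum>i<n. ls ! i:] (f (zip as ls)) + scaleV [:0, 1:] (f (zip as ls)))"
      by (intro poly_map.add poly_map_scalar poly_map_scale poly_scalar_sum poly_scalar_var
          cochains_poly_map[OF assms as]) simp
    then show ?thesis
    proof (rule poly_map.eq_on)
      fix ls :: "complex list"
      assume "length ls = n"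
      then show "scaleV [:\<Sum>i<n. ls ! i:] (f (zip as ls)) + scaleV [:0, 1:] (f (zip as ls)) =
          del_cochain f (zip as ls)"
        using as by (simp add: del_cochain_def sum_list_sum_nth atLeast0LessThan
            flip: V.scale_left_distrib)
    qed
  qed
  then show ?thesis
    using assms cochain_like_del_cochain
    by (auto simp: mem_cochains_iff polynomial_fun_iff del_cochain_def)
qed

lemma add_closed: "f \<in> cochains n \<Longrightarrow> g \<in> cochains n \<Longrightarrow> f + g \<in> cochains n"
  by (auto simp: mem_cochains_iff polynomial_fun_iff plus_fun_def alternating_add poly_map.add
      sesquilinear_def V.scale_right_distrib)

lemma alternating_scale: "alternating f \<Longrightarrow> alternating (\<lambda>xs. scaleV p (f xs))"
  unfolding alternating_def by (metis V.scale_minus_right)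

lemma scale_closed: "f \<in> cochains n \<Longrightarrow> (\<lambda>xs. scaleV p (f xs)) \<in> cochains n"
  by (auto simp: mem_cochains_iff polynomial_fun_iff poly_map_scale alternating_scale
      sesquilinear_def V.scale_right_distrib V.scale_left_commute mult.commute)

lemma uminus_closed: "f \<in> cochains n \<Longrightarrow> - f \<in> cochains n"
  using scale_closed[of f n "- 1"] by (simp add: fun_Compl_def)

lemma zero_closed: "0 \<in> cochains n"
  by (auto simp: mem_cochains_iff polynomial_fun_iff zero_fun_def alternating_def sesquilinear_def
      intro: poly_map.const)

section \<open>The reduced complex\<close>

abbreviation exact_del :: "nat \<Rightarrow> (('a \<times> complex) list \<Rightarrow> 'v) set" where
  "exact_del n \<equiv> del_cochain ` cochains n"

abbreviation del_class :: "nat \<Rightarrow> (('a \<times> complex) list \<Rightarrow> 'v) \<Rightarrow> (('a \<times> complex) list \<Rightarrow> 'v) set" where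
  "del_class n f \<equiv> exact_del n #>\<^bsub>basic_complex n\<^esub> f"

lemma basic_complex_simps [simp]:
  "carrier (basic_complex n) = cochains n"
  "f \<otimes>\<^bsub>basic_complex n\<^esub> g = f + g"
  "\<one>\<^bsub>basic_complex n\<^esub> = 0"
  by (simp_all add: basic_complex_def)

lemma comm_group_basic_complex: "comm_group (basic_complex n)"
proof (rule comm_groupI)
  fix f
  assume "f \<in> carrier (basic_complex n)"
  then show "\<exists>g\<in>carrier (basic_complex n). g \<otimes>\<^bsub>basic_complex n\<^esub> f = \<one>\<^bsub>basic_complex n\<^esub>"
    by (intro bexI[of _ "- f"]) (simp_all add: uminus_closed)
qed (simp_all add: add_closed zero_closed ac_simps)

lemma del_cochain_add: "del_cochain (f + g) = del_cochain f + del_cochain g"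
  by (simp add: del_cochain_def fun_eq_iff V.scale_right_distrib)

lemma del_cochain_minus: "del_cochain (- f) = - del_cochain f"
  by (simp add: del_cochain_def fun_eq_iff)

lemma differential_plus: "differential (f + g) = differential f + differential g"
  by (simp add: fun_eq_iff plus_fun_def differential_add)

lemma normal_exact_del: "exact_del n \<lhd> basic_complex n"
proof (intro comm_group.subgroup_imp_normal[OF comm_group_basic_complex] group.subgroupI)
  interpret G: comm_group "basic_complex n" by (rule comm_group_basic_complex)
  show "group (basic_complex n)" by (rule G.is_group)
  show "exact_del n \<noteq> {}" using zero_closed by blast
  show "exact_del n \<subseteq> carrier (basic_complex n)" using del_cochain_closed by auto
  fix f g
  assume f: "f \<in> exact_del n" and "g \<in> exact_del n"
  then show "f \<otimes>\<^bsub>basic_complex n\<^esub> g \<in> exact_del n"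
    using add_closed by (auto simp flip: del_cochain_add)
  have "- f \<in> exact_del n"
    using f uminus_closed by (auto simp flip: del_cochain_minus)
  moreover have "inv\<^bsub>basic_complex n\<^esub> f = - f"
    using f del_cochain_closed uminus_closed by (intro G.inv_equality) auto
  ultimately show "inv\<^bsub>basic_complex n\<^esub> f \<in> exact_del n" by simp
qed

lemma group_reduced_complex: "group (reduced_complex n)"
  unfolding reduced_complex_def by (rule normal.factorgroup_is_group[OF normal_exact_del])

lemma carrier_reduced_complex: "carrier (reduced_complex n) = del_class n ` cochains n"
  by (simp add: reduced_complex_def carrier_FactGroup)

lemma one_reduced_complex: "\<one>\<^bsub>reduced_complex n\<^esub> = exact_del n"
  by (simp add: reduced_complex_def)

lemma mult_reduced_complex:
  assumes "f \<in> cochains n" "g \<in> cochains n"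
  shows "del_class n f \<otimes>\<^bsub>reduced_complex n\<^esub> del_class n g = del_class n (f + g)"
  using normal.rcos_sum[OF normal_exact_del] assms by (simp add: reduced_complex_def)

lemma mem_del_class_iff: "g \<in> del_class n f \<longleftrightarrow> (\<exists>h\<in>cochains n. g = del_cochain h + f)"
  by (auto simp: r_coset_def)

lemma del_class_eqI:
  assumes "f \<in> cochains n" "h \<in> cochains n" "g = del_cochain h + f"
  shows "del_class n g = del_class n f"
proof -
  interpret G: comm_group "basic_complex n" by (rule comm_group_basic_complex)
  have "g \<in> del_class n f"
    using assms(2,3) by (auto simp: mem_del_class_iff)
  then show ?thesis
    using assms(1) normal_imp_subgroup[OF normal_exact_del]
    by (intro G.repr_independence[symmetric]) simp_all
qed

text \<open>Representatives differ by some \<partial> h, and d \<partial> h = \<partial> d h; the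
  union in \<open>reduced_differential\<close> therefore ranges over a single coset.\<close>

lemma reduced_differential_class:
  assumes "f \<in> cochains n"
  shows "reduced_differential n (del_class n f) = del_class (Suc n) (differential f)"
proof -
  have "del_class (Suc n) (differential g) = del_class (Suc n) (differential f)"
    if g: "g \<in> del_class n f" for g
  proof -
    obtain h where h: "h \<in> cochains n" "g = del_cochain h + f"
      using g unfolding mem_del_class_iff by blast
    then have "differential g = del_cochain (differential h) + differential f"
      using cochainsD by (simp add: differential_plus differential_del_cochain)
    then show ?thesis
      by (rule del_class_eqI[OF differential_closed[OF assms] differential_closed[OF h(1)]])
  qed
  moreover have "f \<in> del_class n f"
    using zero_closed by (auto simp: mem_del_class_iff del_cochain_def fun_eq_iff intro!: bexI[of _ 0])
  ultimately show ?thesis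
    unfolding reduced_differential_def by blast
qed

lemma subgroup_reduced_coboundaries: "subgroup (reduced_coboundaries n) (reduced_complex n)"
proof (cases n)
  case 0
  then show ?thesis
    using group.triv_subgroup[OF group_reduced_complex] by (simp add: reduced_coboundaries_def)
next
  case (Suc m)
  have "reduced_differential m \<in> hom (reduced_complex m) (reduced_complex (Suc m))"
  proof (rule homI)
    fix X Y
    assume "X \<in> carrier (reduced_complex m)" "Y \<in> carrier (reduced_complex m)"
    then obtain f g where "f \<in> cochains m" "g \<in> cochains m" "X = del_class m f" "Y = del_class m g"
      by (auto simp: carrier_reduced_complex)
    then show "reduced_differential m (X \<otimes>\<^bsub>reduced_complex m\<^esub> Y) =
        reduced_differential m X \<otimes>\<^bsub>reduced_complex (Suc m)\<^esub> reduced_differential m Y"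
      by (simp add: mult_reduced_complex reduced_differential_class add_closed differential_closed
          differential_plus)
  qed (auto simp: carrier_reduced_complex reduced_differential_class differential_closed)
  then have "group_hom (reduced_complex m) (reduced_complex (Suc m)) (reduced_differential m)"
    using group_reduced_complex by (simp add: group_hom_def group_hom_axioms_def)
  then show ?thesis
    using group_hom.img_is_subgroup by (simp add: reduced_coboundaries_def Suc)
qed

section \<open>Vanishing of the cohomology\<close>

lemma del_class_0: "del_class n 0 = exact_del n"
  by (auto simp: r_coset_def)

lemma one_mem_reduced_cocycles: "\<one>\<^bsub>reduced_complex n\<^esub> \<in> reduced_cocycles n"
proof -
  have "differential 0 = 0"
    by (intro ext) (simp add: differential_eq_0)
  then have "reduced_differential n (exact_del n) = exact_del (Suc n)"
    using reduced_differential_class[OF zero_closed, of n] by (simp only: del_class_0)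
  moreover have "exact_del n \<in> carrier (reduced_complex n)"
    unfolding carrier_reduced_complex using zero_closed by (rule image_eqI[rotated]) (simp add: del_class_0)
  ultimately show ?thesis
    by (simp add: reduced_cocycles_def kernel_def one_reduced_complex)
qed

text \<open>A coset of a subgroup by one of its own elements is the subgroup itself. That the
  identity is a cocycle ensures that the quotient has an element at all.\<close>

lemma trivial_reduced_cohomology:
  assumes "reduced_cocycles n \<subseteq> reduced_coboundaries n"
  shows "carrier (reduced_cohomology n) = {\<one>\<^bsub>reduced_cohomology n\<^esub>}"
proof -
  have "reduced_coboundaries n #>\<^bsub>reduced_complex n\<lparr>carrier := reduced_cocycles n\<rparr>\<^esub> X = reduced_coboundaries n"
    if "X \<in> reduced_cocycles n" for X
  proof -
    have "reduced_coboundaries n #>\<^bsub>reduced_complex n\<^esub> X = reduced_coboundaries n"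
      using subgroup.rcos_const[OF subgroup_reduced_coboundaries group_reduced_complex] that assms
      by blast
    then show ?thesis by (simp add: r_coset_def)
  qed
  then show ?thesis
    using one_mem_reduced_cocycles[of n]
    by (auto simp: reduced_cohomology_def carrier_FactGroup)
qed

theorem reduced_cohomology_trivial:
  assumes e: "\<And>a. bracket 0 e a = scaleA [:0, 1:] a" "\<And>v. act 0 e v = scaleV [:\<beta>, 1:] v"
    and "\<beta> \<noteq> 0"
  shows "carrier (reduced_cohomology q) = {\<one>\<^bsub>reduced_cohomology q\<^esub>}"
proof (rule trivial_reduced_cohomology, rule subsetI)
  fix X
  assume X: "X \<in> reduced_cocycles q"
  then obtain f where f: "f \<in> cochains q" and Xf: "X = del_class q f"
    by (auto simp: reduced_cocycles_def kernel_def carrier_reduced_complex)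
  have "del_class (Suc q) (differential f) = exact_del (Suc q)"
    using X f by (simp add: Xf reduced_cocycles_def kernel_def one_reduced_complex
        reduced_differential_class)
  moreover have "differential f \<in> del_class (Suc q) (differential f)"
    using zero_closed by (auto simp: mem_del_class_iff del_cochain_def fun_eq_iff intro!: bexI[of _ 0])
  ultimately obtain g where g: "g \<in> cochains (Suc q)" and df: "differential f = del_cochain g"
    by blast
  define k where "k = (\<lambda>ys. scaleV [:1 / \<beta>:] (f ((e, 0) # ys)))"
  define h where "h = (\<lambda>ys. scaleV [:1 / \<beta>:] (g ((e, 0) # ys) - f ys))"
  have h: "h \<in> cochains q"
    using add_closed[OF Cons_closed[OF g, of "(e, 0)"] uminus_closed[OF f]]
    unfolding h_def by (intro scale_closed) (simp add: plus_fun_def fun_Compl_def)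
  have eq: "f = del_cochain h + differential k"
  proof
    fix xs
    \<comment> \<open>The added entry has \<lambda> = 0, so the factor of
      \<open>del_cochain g\<close> at \<open>(e, 0) # xs\<close> is the one belonging to
      \<open>xs\<close>; the term \<open>del_cochain f\<close> is moved to the right and combined
      with it.\<close>
    have "scaleV [:\<beta>:] (f xs) = differential (\<lambda>ys. f ((e, 0) # ys)) xs +
        scaleV [:sum_list (map snd xs), 1:] (g ((e, 0) # xs) - f xs)"
      using homotopy[OF cochainsD[OF f] e, of xs]
      by (simp add: df del_cochain_def V.scale_right_diff_distrib algebra_simps)
    then have "scaleV [:1 / \<beta>:] (scaleV [:\<beta>:] (f xs)) = (del_cochain h + differential k) xs"
      unfolding k_def h_def
      by (simp only: V.scale_right_distrib differential_scale del_cochain_def plus_fun_apply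
          V.scale_left_commute[of "[:1 / \<beta>:]"] add.commute)
    then show "f xs = (del_cochain h + differential k) xs"
      using \<open>\<beta> \<noteq> 0\<close> by (simp flip: one_pCons)
  qed
  show "X \<in> reduced_coboundaries q"
  proof (cases q)
    case 0
    \<comment> \<open>Contraction evaluates the 0-cochain \<open>f\<close> on nonempty lists, where
      it vanishes. What remains is f = \<partial> h, the trivial class.\<close>
    have "differential k = 0"
    proof
      fix xs
      have "k ys = 0" for ys
        using f by (simp add: k_def 0 mem_cochains_iff)
      then show "differential k xs = 0 xs" by (simp add: differential_eq_0)
    qed
    then have "X = del_class q 0"
      unfolding Xf by (intro del_class_eqI[OF zero_closed h]) (use eq in simp)
    then show ?thesis
      by (simp add: 0 del_class_0 reduced_coboundaries_def one_reduced_complex)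
  next
    case (Suc m)
    have k: "k \<in> cochains m"
      unfolding k_def using f by (intro scale_closed Cons_closed) (simp add: Suc)
    have "X = del_class q (differential k)"
      unfolding Xf using differential_closed[OF k] by (intro del_class_eqI[OF _ h eq]) (simp add: Suc)
    also have "\<dots> = reduced_differential m (del_class m k)"
      by (simp add: Suc reduced_differential_class[OF k])
    finally show ?thesis
      using k by (simp add: Suc reduced_coboundaries_def carrier_reduced_complex)
  qed
qed

end

text \<open>The element \<open>e\<close> is L: each bracket of L with a generator has \<partial>
  with coefficient 1, so at \<lambda> = 0 it is \<partial> on the whole algebra. On the module
  \<alpha> occurs only multiplied by \<lambda>, which leaves \<partial> + \<beta>.\<close>

theorem theorem4p5:
  fixes \<alpha> \<beta> :: complex and q :: nat
  assumes "\<beta> \<noteq> 0"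
  shows "carrier (H_SV q \<alpha> \<beta>) = {\<one>\<^bsub>H_SV q \<alpha> \<beta>\<^esub>}"
proof (rule conformal_module.reduced_cohomology_trivial[OF sv_rank_one.conformal_module_axioms _ _ assms])
  show "sv_bracket 0 (sv_basis GenL) a = sv_scale [:0, 1:] a" for a
    by (rule sv_eqI) (simp add: poly_sv_bracket sv_basis_def sv_scale_def split: sv_gen.split)
  show "sv_rank_one_act \<alpha> \<beta> 0 (sv_basis GenL) v = [:\<beta>, 1:] * v" for v
    by (rule cpoly_eqI) (simp add: poly_sv_rank_one_act sv_basis_def algebra_simps)
qed

end
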